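(* Let $p\in\mathbb C[z,\bar z]$ be a polynomial such that $\mathcal Z_p\neq\varnothing$ and $0\notin\mathcal Z_p$. Assume that $\gamma\colon\mathfrak N\to\mathbb C$ is a complex moment sequence which has a representing measure supported in $\mathcal Z_p$. Then the following assertions hold: (i) if $\mu\in\mathcal M(\gamma)$, then $\operatorname{supp}\mu\subset\mathcal Z_p$, $\Gamma(\mu)=\{\Gamma_{m,n}(\mu)\}_{(m,n)\in\mathfrak N_+}\in\mathsf{PDE}(\gamma)$ and $(\mu,0)$ is a representing pair for $\Gamma(\mu)$, where $$\Gamma_{m,n}(\mu)=\int_{\mathbb C^*}z^m\bar z^n\,d\mu(z),\quad (m,n)\in\mathfrak N_+;$$ (ii) if $(\mu,\nu)$ is a representing pair for some $\Gamma\in\mathsf{PDE}(\gamma)$, then $\mu\in\mathcal M(\gamma)$ and $\nu=0$; (iii) if $(\mu_1,0)$ and $(\mu_2,0)$ are representing pairs for some (the same) $\Gamma\in\mathsf{PDE}(\gamma)$, then $\mu_1\circ\psi_p^{-1}=\mu_2\circ\psi_p^{-1}$; (iv) if $Z$ is a nonempty closed subset of $\mathcal Z_p$ such that $\psi|_Z$ is injective, then the mapping $\mathcal M_Z(\gamma)\ni\mu\mapsto\Gamma(\mu)\in\mathsf{PDE}(\gamma)$ is injective, where $\mathcal M_Z(\gamma)=\{\mu\in\mathcal M(\gamma):\operatorname{supp}\mu\subset Z\}$; (v) if $\psi_p$ is injective, then - the mapping $\mathcal M(\gamma)\ni\mu\mapsto\Gamma(\mu)\in\mathsf{PDE}(\gamma)$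 is bijective, - every $\Gamma\in\mathsf{PDE}(\gamma)$ is determinate, - $\mathsf{PDE}(\gamma)$ is of cardinality continuum whenever $\gamma$ is indeterminate.
   Context: All measures are positive, and integrands are tacitly assumed to be absolutely integrable wherever integrals appear. Put $\mathbb C^*=\mathbb C\setminus\{0\}$, $\mathbb T=\{z\in\mathbb C:|z|=1\}$, $\mathfrak N=\{(m,n)\in\mathbb Z^2: m\ge 0,\ n\ge 0\}$ and $\mathfrak N_+=\{(m,n)\in\mathbb Z^2: m+n\ge 0\}$. Convention: $0^0=1$. A sequence $\gamma=\{\gamma_{m,n}\}_{(m,n)\in\mathfrak N}\subset\mathbb C$ is a complex moment sequence if there is a Borel measure $\mu$ on $\mathbb C$ with $\gamma_{m,n}=\int_{\mathbb C} z^m\bar z^n\,d\mu(z)$ for all $(m,n)\in\mathfrak N$; such $\mu$ is called a representing measure for $\gamma$, and $\mathcal M(\gamma)$ denotes the set of all representing measures for $\gamma$. If $\mu$ is unique, $\gamma$ is determinate; otherwise it is indeterminate. $\operatorname{supp}\mu$ is the closed support. A sequence $\Gamma=\{\Gamma_{m,n}\}_{(m,n)\in\mathfrak N_+}\subset\mathbb C$ is positive definite on $\mathfrak N_+$ if $\sum_{(m,n),(p,q)\in\mathfrak N_+}\lambda_{m,n}\overline{\lambda_{p,q}}\,\Gamma_{m+q,n+p}\ge 0$ for every finitely supported family $\{\lambda_{m,n}\}_{(m,n)\in\mathfrak N_+}\subset\mathbb C$. $\mathsf{PDE}(\gamma)$ denotes the set of all sequences $\Gamma$ positive definite on $\mathfrak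 N_+$ with $\Gamma_{m,n}=\gamma_{m,n}$ for all $(m,n)\in\mathfrak N$. A representing pair for $\Gamma\colon\mathfrak N_+\to\mathbb C$ is a pair $(\mu,\nu)$ of Borel measures, $\mu$ on $\mathbb C^*$ and $\nu$ on $\mathbb T$, such that $\Gamma_{m,n}=\int_{\mathbb C^*}z^m\bar z^n\,d\mu(z)+\delta_{m+n,0}\int_{\mathbb T}z^m\bar z^n\,d\nu(z)$ for all $(m,n)\in\mathfrak N_+$, where $\delta_{k,l}$ is the Kronecker delta. If such a pair is unique, $\Gamma$ is called determinate. Borel measures on $\mathbb C^*$ are identified with Borel measures on $\mathbb C$ vanishing on $\{0\}$. For $p\in\mathbb C[z,\bar z]$ (polynomials in two indeterminates with complex coefficients), $\mathcal Z_p=\{z\in\mathbb C:p(z,\bar z)=0\}$. The map $\psi\colon\mathbb C^*\to\mathbb T$ is $\psi(z)=z/\bar z$, and $\psi_p=\psi|_{\mathcal Z_p}$ (when $\mathcal Z_p\ne\varnothing$, $0\notin\mathcal Z_p$). For a Borel measure $\mu$ on $\mathbb C$, $\mu\circ\psi_p^{-1}$ is the Borel measure on $\mathbb T$ given by $(\mu\circ\psi_p^{-1})(\sigma)=\mu(\psi_p^{-1}(\sigma))$ for Borel $\sigma\subset\mathbb T$. *)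

theory Defs
  imports
    "HOL-Analysis.Analysis"
    "HOL-Computational_Algebra.Polynomial"
    "HOL-Library.Equipollence"
    "HOL-Library.FuncSet"
begin

definition NN :: "(int \<times> int) set" where
  "NN = {(m, n). m \<ge> 0 \<and> n \<ge> 0}"

definition NN_plus :: "(int \<times> int) set" where
  "NN_plus = {(m, n). m + n \<ge> 0}"

text \<open>On \<open>NN\<close> the convention \<open>0 powi 0 = 1\<close> of the library is the required one. Negative exponents
  only ever occur in integrals over \<open>- {0}\<close> or over the unit circle.\<close>

definition mono_zz :: "int \<times> int \<Rightarrow> complex \<Rightarrow> complex" where
  "mono_zz = (\<lambda>(m, n) z. z powi m * cnj z powi n)"

text \<open>A polynomial in the two indeterminates \<open>z\<close> and \<open>\<bar>z\<close> is a polynomial in \<open>\<bar>z\<close> whose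
  coefficients are polynomials in \<open>z\<close>; the outer indeterminate is therefore replaced by \<open>cnj z\<close>.\<close>

definition zero_set :: "complex poly poly \<Rightarrow> complex set" where
  "zero_set p = {z. poly (poly p [:cnj z:]) z = 0}"

definition msupp :: "'a::topological_space measure \<Rightarrow> 'a set" where
  "msupp \<mu> = - \<Union>{U. open U \<and> emeasure \<mu> U = 0}"

text \<open>Only the values of \<open>\<gamma>\<close> on \<open>NN\<close> matter.\<close>

definition repr_measures :: "(int \<times> int \<Rightarrow> complex) \<Rightarrow> complex measure set" where
  "repr_measures \<gamma> = {\<mu>. sets \<mu> = sets borel \<and>
     (\<forall>k\<in>NN. integrable \<mu> (mono_zz k) \<and> \<gamma> k = (LINT z|\<mu>. mono_zz k z))}"

definition complex_moment_seq :: "(int \<times> int \<Rightarrow> complex) \<Rightarrow> bool" where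
  "complex_moment_seq \<gamma> \<longleftrightarrow> repr_measures \<gamma> \<noteq> {}"

definition moment_determinate :: "(int \<times> int \<Rightarrow> complex) \<Rightarrow> bool" where
  "moment_determinate \<gamma> \<longleftrightarrow> (\<exists>!\<mu>. \<mu> \<in> repr_measures \<gamma>)"

definition moment_indeterminate :: "(int \<times> int \<Rightarrow> complex) \<Rightarrow> bool" where
  "moment_indeterminate \<gamma> \<longleftrightarrow> complex_moment_seq \<gamma> \<and> \<not> moment_determinate \<gamma>"

definition pos_def_plus :: "(int \<times> int \<Rightarrow> complex) \<Rightarrow> bool" where
  "pos_def_plus \<Gamma> \<longleftrightarrow>
     (\<forall>c :: int \<times> int \<Rightarrow> complex. finite {k \<in> NN_plus. c k \<noteq> 0} \<longrightarrow>
       (\<Sum>(m, n) \<in> {k \<in> NN_plus. c k \<noteq> 0}. \<Sum>(p, q) \<in> {k \<in> NN_plus. c k \<noteq> 0}.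
          c (m, n) * cnj (c (p, q)) * \<Gamma> (m + q, n + p)) \<in> \<real>\<^sub>\<ge>\<^sub>0)"

text \<open>Sequences indexed by \<open>NN_plus\<close> are extensional functions, so that distinct elements
  of \<open>PDE \<gamma>\<close> differ somewhere on \<open>NN_plus\<close>.\<close>

definition PDE :: "(int \<times> int \<Rightarrow> complex) \<Rightarrow> (int \<times> int \<Rightarrow> complex) set" where
  "PDE \<gamma> = {\<Gamma> \<in> NN_plus \<rightarrow>\<^sub>E UNIV. pos_def_plus \<Gamma> \<and> (\<forall>k\<in>NN. \<Gamma> k = \<gamma> k)}"

abbreviation circle :: "complex set" where
  "circle \<equiv> sphere 0 1"

abbreviation borel_circle :: "complex measure" where
  "borel_circle \<equiv> restrict_space borel circle"

text \<open>A Borel measure on \<open>- {0}\<close> is identified with a Borel measure on the whole plane vanishing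
  on \<open>{0}\<close>, whereas \<open>\<nu>\<close> lives on the Borel space of the circle.\<close>

definition representing_pair ::
  "(int \<times> int \<Rightarrow> complex) \<Rightarrow> complex measure \<Rightarrow> complex measure \<Rightarrow> bool" where
  "representing_pair \<Gamma> \<mu> \<nu> \<longleftrightarrow>
     sets \<mu> = sets borel \<and> emeasure \<mu> {0} = 0 \<and> sets \<nu> = sets borel_circle \<and>
     (\<forall>(m, n)\<in>NN_plus.
        set_integrable \<mu> (- {0}) (mono_zz (m, n)) \<and> integrable \<nu> (mono_zz (m, n)) \<and>
        \<Gamma> (m, n) = (LINT z:- {0}|\<mu>. mono_zz (m, n) z)
          + (if m + n = 0 then 1 else 0) * (LINT z|\<nu>. mono_zz (m, n) z))"

definition pair_determinate :: "(int \<times> int \<Rightarrow> complex) \<Rightarrow> bool" where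
  "pair_determinate \<Gamma> \<longleftrightarrow> (\<exists>!x. representing_pair \<Gamma> (fst x) (snd x))"

definition Gamma_of :: "complex measure \<Rightarrow> int \<times> int \<Rightarrow> complex" where
  "Gamma_of \<mu> = (\<lambda>k\<in>NN_plus. LINT z:- {0}|\<mu>. mono_zz k z)"

definition psi :: "complex \<Rightarrow> complex" where
  "psi z = z / cnj z"

text \<open>The image on the circle of the restriction of \<open>\<mu>\<close> to \<open>Z\<close>: a Borel set \<open>\<sigma>\<close> of the circle
  has measure \<open>\<mu> {z \<in> Z. psi z \<in> \<sigma>}\<close>, for Borel \<open>Z\<close> not containing \<open>0\<close>.\<close>

definition psi_image :: "complex set \<Rightarrow> complex measure \<Rightarrow> complex measure" where
  "psi_image Z \<mu> = distr (restrict_space \<mu> Z) borel_circle psi"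

end

theory Submission
  imports
    Defs
    "HOL-Computational_Algebra.Fundamental_Theorem_Algebra"
    "HOL-Probability.Helly_Selection"
begin

text \<open>
Write \<open>u = z / cnj z\<close>. On the punctured plane every monomial \<open>z powi m * cnj z powi n\<close> with
\<open>m + n \<ge> 0\<close> equals \<open>u powi m * cnj z ^ (m + n)\<close>, so a sequence indexed by \<open>NN_plus\<close> is a linear functional
\<open>\<Lambda>\<close> on Laurent polynomials in the unimodular variable \<open>u\<close> with coefficients in the polynomials in \<open>cnj z\<close>.

Let \<open>q\<close> be the function \<open>z \<mapsto> p(z, cnj z)\<close>. That a representing measure of \<open>\<gamma>\<close> is supported in the zero set
of \<open>q\<close> means that the integral of \<open>\<bar>q\<bar>\<^sup>2\<close> vanishes, and this integral is a combination of the numbers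
\<open>\<gamma> k\<close>. Hence one representing measure is carried by the zero set if and only if all are
(\<open>relation_holds_iff\<close>). The same computation for a representing pair has the additional term
\<open>\<bar>q 0\<bar>\<^sup>2\<close> times the mass of the measure on the circle; as \<open>q 0 \<noteq> 0\<close>, that measure is zero
(\<open>representing_pair_relation\<close>). The numbers \<open>\<Gamma> (k, -k)\<close> are the Fourier coefficients of the image of
a representing measure under \<open>psi\<close>, and a finite measure on the circle is determined by its Fourier
coefficients (\<open>circle_measure_eqI\<close>). If \<open>psi\<close> is injective on a closed set carrying the measure,
then the image determines the measure (\<open>pushforward_determines_measure\<close>).

The main point is that every \<open>\<Gamma>\<close> in \<open>PDE \<gamma>\<close> comes from a measure when \<open>psi\<close> is injective on the zero set
(\<open>PDE_represented\<close>). By the theorem of Herglotz and polarization, for each \<open>j\<close> the numbers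
\<open>\<Lambda>(u powi k * cnj z ^ j)\<close> are the Fourier coefficients of a complex measure on the circle; relative to one
dominating measure \<open>\<sigma>\<close> these measures have densities \<open>g j\<close> (\<open>pos_def_disintegration\<close>). For almost every
\<open>u\<close> the numbers \<open>g j u\<close> define, after a rotation that makes \<open>cnj z\<close> real, a positive semidefinite
functional on the polynomials in one real variable. By the Cauchy-Schwarz inequality \<open>\<Lambda>\<close> vanishes
on the ideal generated by \<open>q\<close>, so this functional annihilates the restriction of \<open>q\<close> to the line of all \<open>z\<close> with
\<open>z = u * cnj z\<close>. That restriction is a nonzero polynomial since \<open>q 0 \<noteq> 0\<close>, and by injectivity of \<open>psi\<close>
it has at most one real root. A positive semidefinite functional annihilating a nonzero polynomial with
at most one real root is zero or a multiple of the evaluation at the root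
(\<open>psd_functional_point_evaluation\<close>). The fibers of \<open>\<Lambda>\<close> are therefore point masses on the zero set,
and \<open>\<Lambda>\<close> is integration against the image of a measure on the circle.

Finally, \<open>PDE \<gamma>\<close> is convex, so as soon as it has two elements it contains a segment and has at least the
cardinality of the continuum; it is a set of functions on a countable set, so it has no more.
\<close>

section \<open>Positive semidefinite functionals on polynomials\<close>

text \<open>This is the Cauchy-Schwarz inequality in the form in which it is used here: a vector on which a
positive semidefinite form vanishes lies in the kernel of the form. Perturbing \<open>a\<close> in the direction \<open>e\<close> by
\<open>t\<close> gives the nonnegative expression \<open>2 * Re (cnj t * X) + \<bar>t\<bar>\<^sup>2 * M e e\<close>, which for a small multiple
\<open>t\<close> of \<open>- X\<close> is negative unless \<open>X = 0\<close>.\<close>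

lemma psd_null_vector:
  fixes M :: "'a \<Rightarrow> 'a \<Rightarrow> complex"
  assumes "finite F"
    and psd: "\<And>c. (\<Sum>k\<in>F. \<Sum>l\<in>F. c k * cnj (c l) * M k l) \<in> \<real>\<^sub>\<ge>\<^sub>0"
    and null: "(\<Sum>k\<in>F. \<Sum>l\<in>F. a k * cnj (a l) * M k l) = 0"
    and "e \<in> F"
  shows "(\<Sum>k\<in>F. a k * M k e) = 0"
proof -
  define X where "X = (\<Sum>k\<in>F. a k * M k e)"
  define Y where "Y = (\<Sum>l\<in>F. cnj (a l) * M e l)"
  define m where "m = M e e"
  have form: "t * Y + cnj t * X + t * cnj t * m \<in> \<real>\<^sub>\<ge>\<^sub>0" for t
  proof -
    define d where "d = (\<lambda>k. if k = e then t else 0)"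
    have "(\<Sum>k\<in>F. \<Sum>l\<in>F. (a k + d k) * cnj (a l + d l) * M k l)
       = (\<Sum>k\<in>F. \<Sum>l\<in>F. a k * cnj (a l) * M k l) + (\<Sum>k\<in>F. \<Sum>l\<in>F. d k * cnj (a l) * M k l)
         + (\<Sum>k\<in>F. \<Sum>l\<in>F. a k * cnj (d l) * M k l) + (\<Sum>k\<in>F. \<Sum>l\<in>F. d k * cnj (d l) * M k l)"
      by (simp add: algebra_simps sum.distrib)
    also have "(\<Sum>k\<in>F. \<Sum>l\<in>F. d k * cnj (a l) * M k l)
        = (\<Sum>k\<in>F. if k = e then (\<Sum>l\<in>F. t * cnj (a l) * M e l) else 0)"
      by (intro sum.cong) (auto simp: d_def)
    also have "\<dots> = t * Y"
      using assms(1,4) by (simp add: Y_def sum_distrib_left mult.assoc)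
    also have "(\<Sum>k\<in>F. \<Sum>l\<in>F. a k * cnj (d l) * M k l)
        = (\<Sum>k\<in>F. \<Sum>l\<in>F. if l = e then a k * cnj t * M k e else 0)"
      by (intro sum.cong) (auto simp: d_def)
    also have "\<dots> = cnj t * X"
      using assms(1,4) by (simp add: X_def sum_distrib_left mult_ac)
    also have "(\<Sum>k\<in>F. \<Sum>l\<in>F. d k * cnj (d l) * M k l)
        = (\<Sum>k\<in>F. if k = e then (\<Sum>l\<in>F. if l = e then t * cnj t * M e e else 0) else 0)"
      by (intro sum.cong refl) (auto simp: d_def intro!: sum.cong)
    also have "\<dots> = t * cnj t * m"
      using assms(1,4) by (simp add: m_def)
    finally show ?thesis
      using psd[of "\<lambda>k. a k + d k"] by (simp add: null)
  qed
  have real: "Im (t * Y + cnj t * X + t * cnj t * m) = 0"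
    and pos: "Re (t * Y + cnj t * X + t * cnj t * m) \<ge> 0" for t
    using form[of t] by (auto simp: complex_nonneg_Reals_iff)
  have m: "Im m = 0"
    using real[of 1] real[of "-1"] by simp
  have Y: "Y = cnj X"
    using real[of 1] real[of \<i>] m by (simp add: complex_eq_iff)
  \<comment> \<open>With this step length the quadratic term cannot compensate the linear one.\<close>
  define s where "s = 1 / (\<bar>Re m\<bar> + 1)"
  have s: "s > 0" "s * Re m \<le> 1"
    by (auto simp: s_def field_simps)
  have "0 \<le> Re (- s * X * Y + cnj (- s * X) * X + (- s * X) * cnj (- s * X) * m)"
    using pos[of "- s * X"] .
  also have "\<dots> = - s * (2 - s * Re m) * (norm X)\<^sup>2"
    unfolding cmod_power2 Y using m by (simp add: algebra_simps power2_eq_square)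
  finally have "s * (2 - s * Re m) * (norm X)\<^sup>2 \<le> 0"
    by simp
  moreover have "s * (2 - s * Re m) > 0"
    using s by simp
  ultimately have "(norm X)\<^sup>2 \<le> 0"
    using mult_pos_pos[of _ "(norm X)\<^sup>2"] by (meson not_less)
  then show ?thesis
    by (simp add: X_def)
qed

definition poly_functional :: "(nat \<Rightarrow> complex) \<Rightarrow> complex poly \<Rightarrow> complex" where
  "poly_functional s f = (\<Sum>i\<le>degree f. coeff f i * s i)"

lemma poly_functional_eq:
  assumes "degree f \<le> n"
  shows "poly_functional s f = (\<Sum>i\<le>n. coeff f i * s i)"
  unfolding poly_functional_def using assms
  by (intro sum.mono_neutral_left) (auto simp: coeff_eq_0)

lemma poly_functional_add: "poly_functional s (f + g) = poly_functional s f + poly_functional s g"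
proof -
  define n where "n = max (degree f) (degree g)"
  have "degree (f + g) \<le> n" "degree f \<le> n" "degree g \<le> n"
    by (auto simp: n_def degree_add_le_max)
  then show ?thesis
    by (simp add: poly_functional_eq[where n = n] algebra_simps sum.distrib)
qed

lemma poly_functional_smult: "poly_functional s (smult c f) = c * poly_functional s f"
  by (simp add: poly_functional_eq[where n = "degree f"] sum_distrib_left mult_ac)

lemma poly_functional_0 [simp]: "poly_functional s 0 = 0"
  by (simp add: poly_functional_def)

lemma poly_functional_sum: "poly_functional s (\<Sum>i\<in>A. f i) = (\<Sum>i\<in>A. poly_functional s (f i))"
  by (induction A rule: infinite_finite_induct) (auto simp: poly_functional_add)

lemma poly_functional_monom: "poly_functional s (monom a i) = a * s i"
  by (subst poly_functional_eq[where n = i]) (auto simp: degree_monom_le if_distrib[of "\<lambda>x. x * _"] cong: if_cong)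

lemma poly_functional_mult:
  assumes "degree f \<le> m" "degree g \<le> n"
  shows "poly_functional s (f * g) = (\<Sum>j\<le>m. \<Sum>l\<le>n. coeff f j * coeff g l * s (j + l))"
proof -
  have "f * g = (\<Sum>j\<le>m. monom (coeff f j) j) * (\<Sum>l\<le>n. monom (coeff g l) l)"
    using assms by (simp add: poly_as_sum_of_monoms')
  also have "\<dots> = (\<Sum>j\<le>m. \<Sum>l\<le>n. monom (coeff f j * coeff g l) (j + l))"
    by (simp add: sum_product mult_monom)
  finally show ?thesis
    by (simp add: poly_functional_sum poly_functional_monom)
qed

text \<open>The Cauchy-Schwarz inequality for the form sending \<open>f\<close> and \<open>h\<close> to the value of the functional at
\<open>f * map_poly cnj h\<close>; only the two-dimensional space spanned by \<open>f\<close> and the conjugate of \<open>g\<close> matters.\<close>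

lemma psd_functional_null:
  assumes psd: "\<And>f. poly_functional s (f * map_poly cnj f) \<in> \<real>\<^sub>\<ge>\<^sub>0"
    and null: "poly_functional s (f * map_poly cnj f) = 0"
  shows "poly_functional s (f * g) = 0"
proof -
  have cnj_add: "map_poly cnj (p + q) = map_poly cnj p + map_poly cnj q" for p q
    by (rule poly_eqI) (simp add: coeff_map_poly)
  have cnj_smult: "map_poly cnj (smult c q) = smult (cnj c) (map_poly cnj q)" for c q
    by (rule poly_eqI) (simp add: coeff_map_poly)
  have cnj_cnj: "map_poly cnj (map_poly cnj q) = q" for q
    by (rule poly_eqI) (simp add: coeff_map_poly)
  define h where "h = (\<lambda>b. if b then map_poly cnj g else f)"
  define M where "M k l = poly_functional s (h k * map_poly cnj (h l))" for k l
  have "(\<Sum>k\<in>{False, True}. of_bool (\<not> k) * M k True) = 0"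
  proof (rule psd_null_vector)
    fix c :: "bool \<Rightarrow> complex"
    let ?f = "smult (c False) (h False) + smult (c True) (h True)"
    have "(\<Sum>k\<in>{False, True}. \<Sum>l\<in>{False, True}. c k * cnj (c l) * M k l)
          = poly_functional s (?f * map_poly cnj ?f)"
      by (simp add: M_def cnj_add cnj_smult algebra_simps poly_functional_add poly_functional_smult)
    then show "(\<Sum>k\<in>{False, True}. \<Sum>l\<in>{False, True}. c k * cnj (c l) * M k l) \<in> \<real>\<^sub>\<ge>\<^sub>0"
      using psd by simp
  qed (use null in \<open>auto simp: M_def h_def\<close>)
  then show ?thesis
    by (simp add: M_def h_def cnj_cnj)
qed

text \<open>The polynomials annihilated by a positive semidefinite functional form a real radical ideal, and the
proof lowers the degree of \<open>P\<close> within this ideal. If \<open>P = (X - w) * S\<close> with \<open>w\<close> not real, then \<open>S\<close> is also annihilated: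
the functional takes real values at \<open>S * cnj S\<close> and \<open>X * S * cnj S\<close>, and the second value is
\<open>w\<close> times the first. If the real root \<open>r\<close> is multiple, \<open>P = (X - r)\<^sup>2 * T\<close>, then the square of
\<open>(X - r) * T\<close> is a multiple of \<open>P\<close>, so one factor \<open>X - r\<close> can be dropped. What remains is a
nonzero constant or a multiple of \<open>X - r\<close>.\<close>

proposition psd_functional_point_evaluation:
  fixes P :: "complex poly"
  assumes psd: "\<And>f. poly_functional s (f * map_poly cnj f) \<in> \<real>\<^sub>\<ge>\<^sub>0"
    and "P \<noteq> 0" "\<And>f. poly_functional s (P * f) = 0"
    and "\<And>r r' :: real. poly P (of_real r) = 0 \<Longrightarrow> poly P (of_real r') = 0 \<Longrightarrow> r = r'"
  shows "(\<forall>j. s j = 0) \<or> (\<exists>r :: real. poly P (of_real r) = 0 \<and> (\<forall>j. s j = s 0 * of_real r ^ j))"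
  using assms(2-)
proof (induction "degree P" arbitrary: P rule: less_induct)
  case less
  note null = psd_functional_null[OF psd]
  \<comment> \<open>An annihilated proper factor of \<open>P\<close> can replace \<open>P\<close>, as its roots are roots of \<open>P\<close>.\<close>
  have shrink: ?case
    if S: "P = R * S" "degree S < degree P" "poly_functional s (S * map_poly cnj S) = 0" for R S
  proof -
    have "(\<forall>j. s j = 0) \<or> (\<exists>r :: real. poly S (of_real r) = 0 \<and> (\<forall>j. s j = s 0 * of_real r ^ j))"
    proof (rule less.hyps)
      show "S \<noteq> 0" using S(1) less.prems(1) by auto
      show "poly_functional s (S * f) = 0" for f
        by (rule null) fact
      show "r = r'" if "poly S (of_real r) = 0" "poly S (of_real r') = 0" for r r' :: real
        using that less.prems(3)[of r r'] by (simp add: S(1))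
    qed fact
    then show ?thesis
      by (auto simp: S(1))
  qed
  have root_factor: "\<exists>S. Q = [:-w, 1:] * S \<and> degree Q = Suc (degree S)" if Q: "poly Q w = 0" "Q \<noteq> 0"
    for Q :: "complex poly" and w
  proof -
    obtain S where S: "Q = [:-w, 1:] * S"
      using Q(1) unfolding poly_eq_0_iff_dvd by (elim dvdE)
    with Q(2) have "S \<noteq> 0" by auto
    then have "degree Q = Suc (degree S)"
      unfolding S by (subst degree_mult_eq) auto
    with S show ?thesis by blast
  qed
  show ?case
  proof (cases "\<exists>w. poly P w = 0 \<and> Im w \<noteq> 0")
    case True
    then obtain w where w: "poly P w = 0" "Im w \<noteq> 0" by blast
    then obtain S where S: "P = [:-w, 1:] * S" "degree P = Suc (degree S)"
      using root_factor less.prems(1) by blast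
    let ?SS = "S * map_poly cnj S"
    have cnj_SS: "map_poly cnj ([:a, of_real b:] * S) = [:cnj a, of_real b:] * map_poly cnj S" for a b
      by (rule poly_eqI) (simp add: coeff_map_poly coeff_pCons split: nat.splits)
    have real: "Im (poly_functional s (([:of_real a, of_real b:] * S) * map_poly cnj ([:of_real a, of_real b:] * S))) = 0"
      for a b :: real
      using psd[of "[:of_real a, of_real b:] * S"] unfolding complex_nonneg_Reals_iff by blast
    have expand: "([:of_real a, of_real b:] * S) * map_poly cnj ([:of_real a, of_real b:] * S)
        = smult (of_real (a\<^sup>2)) ?SS + smult (2 * of_real (a * b)) ([:0, 1:] * ?SS)
          + smult (of_real (b\<^sup>2)) ([:0, 0, 1:] * ?SS)" for a b :: real
    proof -
      have "[:of_real a, of_real b:] * [:of_real a, of_real b:]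
          = smult (of_real (a\<^sup>2)) 1 + smult (2 * of_real (a * b)) [:0, 1:] + smult (of_real (b\<^sup>2)) [:0, 0, 1 :: complex:]"
        by (simp add: power2_eq_square)
      then have "([:of_real a, of_real b:] * [:of_real a, of_real b:]) * ?SS
          = (smult (of_real (a\<^sup>2)) 1 + smult (2 * of_real (a * b)) [:0, 1:] + smult (of_real (b\<^sup>2)) [:0, 0, 1:]) * ?SS"
        by (rule arg_cong)
      then show ?thesis
        unfolding cnj_SS distrib_right mult_smult_left mult_1_left complex_cnj_complex_of_real by (simp only: mult_ac)
    qed
    have imag: "Im (poly_functional s ?SS) = 0" "Im (poly_functional s ([:0, 1:] * ?SS)) = 0"
      using real[of 1 0] real[of 0 1] real[of 1 1] unfolding expand
      by (simp_all add: poly_functional_add poly_functional_smult del: mult_pCons_left mult_pCons_right)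
    have "[:0, 1:] * ?SS = P * map_poly cnj S + smult w ?SS"
      by (simp add: S(1) algebra_simps)
    then have "poly_functional s ([:0, 1:] * ?SS) = w * poly_functional s ?SS"
      using less.prems(2) by (simp only: poly_functional_add poly_functional_smult add_0_left)
    with imag w(2) have "poly_functional s ?SS = 0"
      by (auto simp: complex_eq_iff)
    then show ?thesis
      by (intro shrink[OF S(1)]) (simp_all add: S(2))
  next
    case False
    then have real: "w = of_real (Re w)" if "poly P w = 0" for w
      using that by (auto simp: complex_eq_iff)
    show ?thesis
    proof (cases "degree P = 0")
      case True
      then obtain c where c: "P = [:c:]" by (rule degree_eq_zeroE)
      with less.prems(1) have "c \<noteq> 0" by auto
      have "s j = 0" for j
        using less.prems(2)[of "monom 1 j"] \<open>c \<noteq> 0\<close>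
        by (simp add: c poly_functional_smult poly_functional_monom)
      then show ?thesis by blast
    next
      case False
      then obtain w where w: "poly P w = 0"
        using fundamental_theorem_of_algebra[of P] False by (auto simp: constant_degree)
      define r where "r = Re w"
      from w real have r: "poly P (of_real r) = 0" by (metis r_def)
      then obtain S where S: "P = [:-of_real r, 1:] * S" "degree P = Suc (degree S)"
        using root_factor less.prems(1) by blast
      have unique: "w = of_real r" if "poly P w = 0" for w
        using less.prems(3)[of "Re w" r] real[OF that] that r by metis
      show ?thesis
      proof (cases "degree S = 0")
        case True
        then obtain c where c: "S = [:c:]" by (rule degree_eq_zeroE)
        with S less.prems(1) have "c \<noteq> 0" by auto
        have "s (Suc j) = of_real r * s j" for j
        proof -
          have "P * monom 1 j = monom c (Suc j) + monom (- of_real r * c) j"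
            by (rule poly_eqI) (simp add: S c monom_altdef algebra_simps)
          then show ?thesis
            using less.prems(2)[of "monom 1 j"] \<open>c \<noteq> 0\<close>
            by (simp add: poly_functional_add poly_functional_monom)
        qed
        then have "s j = s 0 * of_real r ^ j" for j
          by (induction j) auto
        with r show ?thesis by blast
      next
        case False
        then obtain w where w: "poly S w = 0"
          using fundamental_theorem_of_algebra[of S] False by (auto simp: constant_degree)
        then have "w = of_real r" by (intro unique) (simp add: S(1))
        moreover have "S \<noteq> 0" using False by auto
        ultimately obtain T where T: "S = [:-of_real r, 1:] * T"
          using w root_factor[of S w] by blast
        show ?thesis
        proof (rule shrink[OF S(1)])
          have "map_poly cnj S = [:-of_real r, 1:] * map_poly cnj T"
            by (rule poly_eqI) (simp add: T coeff_map_poly coeff_pCons split: nat.splits)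
          then have "S * map_poly cnj S = P * map_poly cnj T"
            by (simp only: S(1) T mult_ac)
          then show "poly_functional s (S * map_poly cnj S) = 0"
            using less.prems(2) by simp
        qed (simp add: S(2))
      qed
    qed
  qed
qed

section \<open>Measures on the unit circle and their moments\<close>

text \<open>Measures on the circle are kept as Borel measures on the plane, so that they can be images of maps
into the plane without a change of the measurable space.\<close>

definition circle_measure :: "complex measure \<Rightarrow> bool" where
  "circle_measure \<sigma> \<longleftrightarrow> finite_measure \<sigma> \<and> sets \<sigma> = sets borel \<and> (AE u in \<sigma>. norm u = 1)"

lemma borel_measurable_power_int [measurable (raw)]:
  assumes "f \<in> borel_measurable M"
  shows "(\<lambda>x. f x powi k :: complex) \<in> borel_measurable M"
  using assms by (cases "k \<ge> 0") (simp_all add: power_int_def)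

lemma integrable_bounded_mult:
  fixes F G :: "complex \<Rightarrow> complex"
  assumes "integrable \<sigma> G" "F \<in> borel_measurable \<sigma>" "AE u in \<sigma>. norm (F u) \<le> B"
  shows "integrable \<sigma> (\<lambda>u. F u * G u)"
proof (rule Bochner_Integration.integrable_bound)
  show "integrable \<sigma> (\<lambda>u. B * norm (G u))"
    using assms(1) by simp
  show "(\<lambda>u. F u * G u) \<in> borel_measurable \<sigma>"
    using assms(1,2) by auto
  show "AE u in \<sigma>. norm (F u * G u) \<le> norm (B * norm (G u))"
    using assms(3)
  proof eventually_elim
    case (elim u)
    then have "norm (F u) \<le> \<bar>B\<bar>" by linarith
    then show ?case
      by (simp add: norm_mult mult_right_mono abs_mult)
  qed
qed

lemma circle_integrable_powi:
  assumes "circle_measure \<sigma>" "integrable \<sigma> G"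
  shows "integrable \<sigma> (\<lambda>u. u powi k * G u)"
proof (rule integrable_bounded_mult[OF assms(2)])
  have [measurable_cong]: "sets \<sigma> = sets borel"
    using assms(1) by (simp add: circle_measure_def)
  show "(\<lambda>u. u powi k) \<in> borel_measurable \<sigma>"
    by measurable
  show "AE u in \<sigma>. norm (u powi k) \<le> 1"
    using assms(1) by (auto simp: circle_measure_def norm_power_int)
qed

text \<open>On the circle the restrictions of polynomials in \<open>Re u\<close> and \<open>Im u\<close> are trigonometric
polynomials, and these are uniformly dense by the Stone-Weierstrass theorem. In place of an explicit
representation of trigonometric polynomials, the proof uses the space \<open>W\<close> of functions that satisfy the
equation together with all their products with powers of \<open>u\<close>; it is stable under multiplication by
\<open>u\<close> and \<open>cnj u\<close>, hence by polynomials.\<close>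

lemma circle_moments_determine_integral:
  fixes G :: "complex \<Rightarrow> complex" and \<phi> :: "complex \<Rightarrow> real"
  assumes \<sigma>: "circle_measure \<sigma>" and \<rho>: "circle_measure \<rho>" and G: "integrable \<sigma> G"
    and moments: "\<And>k :: int. (LINT u|\<sigma>. u powi k * G u) = (LINT u|\<rho>. u powi k)"
    and \<phi>: "continuous_on UNIV \<phi>"
  shows "(LINT u|\<sigma>. of_real (\<phi> u) * G u) = (LINT u|\<rho>. of_real (\<phi> u))"
proof -
  have [measurable_cong]: "sets \<sigma> = sets borel" "sets \<rho> = sets borel"
    and [simp]: "finite_measure \<sigma>" "finite_measure \<rho>"
    and circle: "AE u in \<sigma>. norm u = 1" "AE u in \<rho>. norm u = 1"
    using \<sigma> \<rho> by (auto simp: circle_measure_def)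
  have [measurable]: "G \<in> borel_measurable \<sigma>"
    using G by auto
  have one: "integrable \<rho> (\<lambda>_. 1 :: complex)"
    by (simp add: finite_measure.integrable_const)
  have bounded: "\<exists>B. AE u in \<tau>. norm (F u) \<le> B"
    if "continuous_on UNIV F" "AE u in \<tau>. norm u = 1" for F :: "complex \<Rightarrow> complex" and \<tau>
  proof -
    have "compact (F ` sphere 0 1)"
      using that(1) by (intro compact_continuous_image) (auto intro: continuous_on_subset)
    then obtain B where B: "\<And>x. x \<in> F ` sphere 0 1 \<Longrightarrow> norm x \<le> B"
      using compact_imp_bounded bounded_iff by metis
    show ?thesis
      using that(2) B by (intro exI[of _ B]) (auto elim!: eventually_mono)
  qed
  \<comment> \<open>Functions for which the claim holds after multiplication by any power of \<open>u\<close>.\<close>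
  define W where "W = {F. continuous_on UNIV F \<and>
    (\<forall>k :: int. (LINT u|\<sigma>. u powi k * (F u * G u)) = (LINT u|\<rho>. u powi k * F u))}"
  have cont_meas: "F \<in> borel_measurable \<sigma>" "F \<in> borel_measurable \<rho>"
    if "continuous_on UNIV F" for F :: "complex \<Rightarrow> complex"
    using borel_measurable_continuous_onI[OF that] by simp_all
  have int\<sigma>: "integrable \<sigma> (\<lambda>u. u powi k * (F u * G u))" if F: "continuous_on UNIV F" for F k
  proof -
    obtain B where "AE u in \<sigma>. norm (F u) \<le> B"
      using bounded[OF F circle(1)] by blast
    then have "integrable \<sigma> (\<lambda>u. F u * G u)"
      using F by (intro integrable_bounded_mult[OF G] cont_meas)
    then show ?thesis
      by (rule circle_integrable_powi[OF \<sigma>])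
  qed
  have int\<rho>: "integrable \<rho> (\<lambda>u. u powi k * F u)" if F: "continuous_on UNIV F" for F k
  proof -
    obtain B where "AE u in \<rho>. norm (F u) \<le> B"
      using bounded[OF F circle(2)] by blast
    then have "integrable \<rho> (\<lambda>u. F u * 1)"
      using F by (intro integrable_bounded_mult[OF one] cont_meas)
    then show ?thesis
      using circle_integrable_powi[OF \<rho>, of F k] by simp
  qed
  have W_add: "(\<lambda>u. F u + H u) \<in> W" if "F \<in> W" "H \<in> W" for F H
    using that int\<sigma> int\<rho> by (auto simp: W_def distrib_left distrib_right intro!: continuous_intros)
  have W_scale: "(\<lambda>u. c * F u) \<in> W" if "F \<in> W" for F c
    using that by (auto simp: W_def mult.left_commute[of _ c] mult.assoc[of c] intro!: continuous_intros)
  have W_shift: "(\<lambda>u. H u * F u) \<in> W"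
    if F: "F \<in> W" and H: "continuous_on UNIV H" "\<And>u. norm u = 1 \<Longrightarrow> H u = u powi i" for F H and i :: int
  proof -
    have [measurable]: "H \<in> borel_measurable borel" "F \<in> borel_measurable borel"
      using H F by (auto intro: borel_measurable_continuous_onI simp: W_def)
    have shift: "u powi k * (H u * w) = u powi (k + i) * w" if "norm u = 1" for u k w
    proof -
      have "u \<noteq> 0" using that by auto
      then show ?thesis
        using H(2)[OF that] by (simp add: power_int_add mult.assoc)
    qed
    have "(LINT u|\<sigma>. u powi k * (H u * F u * G u)) = (LINT u|\<rho>. u powi k * (H u * F u))" for k
    proof -
      have "(LINT u|\<sigma>. u powi k * (H u * F u * G u)) = (LINT u|\<sigma>. u powi (k + i) * (F u * G u))"
        using circle(1) by (intro integral_cong_AE; measurable) (erule eventually_mono; simp only: shift mult.assoc)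
      also have "\<dots> = (LINT u|\<rho>. u powi (k + i) * F u)"
        using F by (simp add: W_def)
      also have "\<dots> = (LINT u|\<rho>. u powi k * (H u * F u))"
        using circle(2) by (intro integral_cong_AE; measurable) (erule eventually_mono; simp only: shift)
      finally show ?thesis .
    qed
    with F H(1) show ?thesis
      by (auto simp: W_def intro!: continuous_intros)
  qed
  have W_mult: "(\<lambda>u. u * F u) \<in> W" if "F \<in> W" for F
    by (rule W_shift[OF that, of _ 1]) (auto intro!: continuous_intros)
  have W_cnj: "(\<lambda>u. cnj u * F u) \<in> W" if "F \<in> W" for F
  proof (rule W_shift[OF that, of _ "-1"])
    show "cnj u = u powi -1" if "norm u = 1" for u
      using that by (simp add: power_int_minus divide_conv_cnj inverse_eq_divide)
  qed (auto intro!: continuous_intros)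
  have W_poly: "(\<lambda>u. of_real (q u) * F u) \<in> W" if "real_polynomial_function q" "F \<in> W" for q F
    using that
  proof (induction arbitrary: F)
    case (linear f)
    note F = \<open>F \<in> W\<close>
    interpret bounded_linear f by fact
    have f: "of_real (f u) * F u = of_real (f 1) * ((1/2) * (u * F u) + (1/2) * (cnj u * F u))
        + of_real (f \<i>) * ((-\<i>/2) * (u * F u) + (\<i>/2) * (cnj u * F u))" for u
    proof -
      have "f u = f (Re u *\<^sub>R 1 + Im u *\<^sub>R \<i>)"
        by (rule arg_cong[of _ _ f]) (simp add: complex_eq_iff)
      also have "\<dots> = Re u * f 1 + Im u * f \<i>"
        by (simp add: add scaleR)
      finally have f: "f u = Re u * f 1 + Im u * f \<i>" .
      show ?thesis
        unfolding f by (simp add: complex_eq_iff field_simps)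
    qed
    show ?case
      using F unfolding f by (intro W_add W_scale W_mult W_cnj)
  next
    case (const c)
    then show ?case by (rule W_scale)
  next
    case (add f g)
    show ?case
      using W_add[OF add.IH(1)[OF add.prems] add.IH(2)[OF add.prems]] by (simp add: distrib_right)
  next
    case (mult f g)
    show ?case
      using mult.IH(1)[OF mult.IH(2)[OF mult.prems]] by (simp add: mult.assoc)
  qed
  have "(\<lambda>u. 1) \<in> W"
    using moments by (simp add: W_def)
  note poly = W_poly[OF _ this]
  let ?I = "LINT u|\<sigma>. of_real (\<phi> u) * G u" and ?J = "LINT u|\<rho>. of_real (\<phi> u) :: complex"
  define C where "C = (LINT u|\<sigma>. norm (G u)) + measure \<rho> (space \<rho>)"
  have approx: "norm (?I - ?J) \<le> e * C" if "e > 0" for e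
  proof -
    obtain q where q: "real_polynomial_function q" "\<And>u. u \<in> sphere 0 1 \<Longrightarrow> \<bar>\<phi> u - q u\<bar> < e"
      using Stone_Weierstrass_real_polynomial_function[of "sphere 0 1 :: complex set" \<phi> e] \<phi> \<open>e > 0\<close>
      by (metis compact_sphere continuous_on_subset subset_UNIV)
    have cont: "continuous_on UNIV q"
      using q(1) continuous_on_polymonial_function real_polynomial_function_eq by blast
    have [measurable]: "q \<in> borel_measurable borel" "\<phi> \<in> borel_measurable borel"
      using cont \<phi> by (auto intro: borel_measurable_continuous_onI)
    have eq: "(LINT u|\<sigma>. of_real (q u) * G u) = (LINT u|\<rho>. of_real (q u))"
      using poly[OF q(1)] by (auto simp: W_def dest: spec[of _ 0])
    have cc: "continuous_on UNIV (\<lambda>u. complex_of_real (q u))" "continuous_on UNIV (\<lambda>u. complex_of_real (\<phi> u))"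
      using cont \<phi> by (auto intro!: continuous_intros)
    have int: "integrable \<sigma> (\<lambda>u. of_real (\<phi> u) * G u)" "integrable \<sigma> (\<lambda>u. of_real (q u) * G u)"
      "integrable \<rho> (\<lambda>u. complex_of_real (\<phi> u))" "integrable \<rho> (\<lambda>u. complex_of_real (q u))"
      using int\<sigma>[of _ 0] int\<rho>[of _ 0] cc by simp_all
    have "norm (LINT u|\<sigma>. of_real (\<phi> u) * G u - of_real (q u) * G u) \<le> (LINT u|\<sigma>. e * norm (G u))"
    proof (rule order.trans[OF integral_norm_bound integral_mono_AE])
      show "AE u in \<sigma>. norm (of_real (\<phi> u) * G u - of_real (q u) * G u) \<le> e * norm (G u)"
        using circle(1)
      proof eventually_elim
        case (elim u)
        then have "\<bar>\<phi> u - q u\<bar> \<le> e" using q(2)[of u] by simp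
        then have "norm (complex_of_real (\<phi> u - q u)) \<le> e" by (simp only: norm_of_real)
        then show ?case
          by (simp add: norm_mult mult_right_mono flip: left_diff_distrib of_real_diff)
      qed
    qed (use int G in auto)
    moreover have "norm (LINT u|\<rho>. of_real (\<phi> u) - of_real (q u) :: complex) \<le> (LINT u|\<rho>. e)"
    proof (rule order.trans[OF integral_norm_bound integral_mono_AE])
      show "AE u in \<rho>. norm (of_real (\<phi> u) - of_real (q u) :: complex) \<le> e"
        using circle(2)
      proof eventually_elim
        case (elim u)
        then have "\<bar>\<phi> u - q u\<bar> \<le> e" using q(2)[of u] by simp
        then show ?case
          by (simp flip: of_real_diff)
      qed
    qed (use int in \<open>auto simp: finite_measure.integrable_const\<close>)
    ultimately have "norm (?I - (LINT u|\<sigma>. of_real (q u) * G u)) \<le> e * (LINT u|\<sigma>. norm (G u))"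
      "norm (?J - (LINT u|\<rho>. of_real (q u))) \<le> e * measure \<rho> (space \<rho>)"
      using int by (simp_all add: mult.commute)
    then show ?thesis
      unfolding eq C_def distrib_left
      using norm_triangle_ineq4[of "?I - (LINT u|\<rho>. of_real (q u))" "?J - (LINT u|\<rho>. of_real (q u))"]
      by simp
  qed
  have "C \<ge> 0"
    by (auto simp: C_def)
  have "norm (?I - ?J) \<le> 0 + e" if "e > 0" for e
  proof -
    have "norm (?I - ?J) \<le> e / (C + 1) * C"
      using \<open>e > 0\<close> \<open>C \<ge> 0\<close> by (intro approx) auto
    also have "\<dots> \<le> e"
      using \<open>e > 0\<close> \<open>C \<ge> 0\<close> by (simp add: field_simps)
    finally show ?thesis by simp
  qed
  then have "norm (?I - ?J) \<le> 0"
    by (rule field_le_epsilon)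
  then show ?thesis by simp
qed

text \<open>Indicators of closed sets are limits of continuous functions, and the closed sets form a generator of
the Borel sets that is stable under intersection.\<close>

lemma circle_moments_determine_measure:
  fixes G :: "complex \<Rightarrow> complex"
  assumes \<sigma>: "circle_measure \<sigma>" and \<rho>: "circle_measure \<rho>" and G: "integrable \<sigma> G"
    and moments: "\<And>k :: int. (LINT u|\<sigma>. u powi k * G u) = (LINT u|\<rho>. u powi k)"
    and A: "A \<in> sets borel"
  shows "(LINT u:A|\<sigma>. G u) = of_real (measure \<rho> A)"
proof -
  have sets [measurable_cong]: "sets \<sigma> = sets borel" "sets \<rho> = sets borel"
    and fin: "finite_measure \<sigma>" "finite_measure \<rho>"
    using \<sigma> \<rho> by (auto simp: circle_measure_def)
  then interpret \<rho>: finite_measure \<rho> by simp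
  have [measurable]: "G \<in> borel_measurable \<sigma>"
    using G by auto
  have sp: "space \<sigma> = UNIV" "space \<rho> = UNIV"
    using sets[THEN sets_eq_imp_space_eq] by auto
  have closed: "(LINT u:C|\<sigma>. G u) = of_real (measure \<rho> C)" if C: "closed C" for C
  proof (cases "C = {}")
    case False
    \<comment> \<open>Continuous functions decreasing to the indicator of \<open>C\<close>.\<close>
    define \<phi> where "\<phi> n u = max 0 (1 - real n * infdist u C)" for n u
    have cont: "continuous_on UNIV (\<phi> n)" for n
      unfolding \<phi>_def by (intro continuous_intros)
    have [measurable]: "\<phi> n \<in> borel_measurable borel" for n
      using cont by (rule borel_measurable_continuous_onI)
    have [measurable]: "C \<in> sets borel"
      using C by auto
    have lim: "(\<lambda>n. \<phi> n u) \<longlonglongrightarrow> indicator C u" for u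
    proof (cases "u \<in> C")
      case False
      then have "infdist u C > 0"
        using C \<open>C \<noteq> {}\<close> by (intro infdist_pos_not_in_closed)
      then have "\<forall>\<^sub>F n in sequentially. 1 / infdist u C \<le> real n"
        using filterlim_real_sequentially by (simp add: filterlim_at_top)
      then have "\<forall>\<^sub>F n in sequentially. \<phi> n u = 0"
        by eventually_elim (use \<open>infdist u C > 0\<close> in \<open>simp add: \<phi>_def field_simps\<close>)
      with False show ?thesis
        by (simp add: tendsto_eventually)
    qed (simp add: \<phi>_def)
    have le1: "\<bar>\<phi> n u\<bar> \<le> 1" for n u
      by (auto simp: \<phi>_def infdist_nonneg)
    have "(\<lambda>n. LINT u|\<sigma>. of_real (\<phi> n u) * G u) \<longlonglongrightarrow> (LINT u|\<sigma>. of_real (indicator C u) * G u)"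
    proof (rule integral_dominated_convergence)
      show "integrable \<sigma> (\<lambda>u. norm (G u))" using G by simp
      show "AE u in \<sigma>. norm (of_real (\<phi> n u) * G u) \<le> norm (G u)" for n
        using le1 by (auto simp: norm_mult intro!: mult_left_le_one_le)
      show "AE u in \<sigma>. (\<lambda>n. of_real (\<phi> n u) * G u) \<longlonglongrightarrow> of_real (indicator C u) * G u"
        using lim by (auto intro!: tendsto_intros)
    qed measurable
    moreover have "(\<lambda>n. LINT u|\<rho>. complex_of_real (\<phi> n u)) \<longlonglongrightarrow> (LINT u|\<rho>. of_real (indicator C u))"
    proof (rule integral_dominated_convergence)
      show "integrable \<rho> (\<lambda>u. 1)" by simp
      show "AE u in \<rho>. norm (complex_of_real (\<phi> n u)) \<le> 1" for n
        using le1 by auto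
      show "AE u in \<rho>. (\<lambda>n. complex_of_real (\<phi> n u)) \<longlonglongrightarrow> of_real (indicator C u)"
        using lim by (auto intro!: tendsto_intros)
    qed measurable
    ultimately have "(LINT u|\<sigma>. of_real (indicator C u) * G u) = (LINT u|\<rho>. of_real (indicator C u))"
      unfolding circle_moments_determine_integral[OF \<sigma> \<rho> G moments cont] by (rule LIMSEQ_unique)
    then show ?thesis
      by (simp add: set_lebesgue_integral_def scaleR_conv_of_real sp)
  qed (simp add: set_lebesgue_integral_def)
  have int: "set_integrable \<sigma> B G" if "B \<in> sets borel" for B
    using G that by (auto simp: set_integrable_def sets intro!: integrable_mult_indicator)
  have Int_stable_closed: "Int_stable (Collect closed :: complex set set)"
    and closed_sub: "Collect closed \<subseteq> Pow (UNIV :: complex set)"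
    by (auto simp: Int_stable_def)
  have "A \<in> sigma_sets UNIV (Collect closed)"
    using A by (simp add: borel_eq_closed)
  with Int_stable_closed closed_sub show ?thesis
  proof (induction rule: sigma_sets_induct_disjoint)
    case (compl B)
    then have B: "B \<in> sets borel" by (simp add: borel_eq_closed)
    have "(LINT u:UNIV|\<sigma>. G u) = (LINT u:B|\<sigma>. G u) + (LINT u:- B|\<sigma>. G u)"
      using set_integral_Un[of B "- B" \<sigma> G] int[OF B] int[of "- B"] B by (simp add: Compl_partition)
    moreover have "measure \<rho> (UNIV - B) = measure \<rho> UNIV - measure \<rho> B"
      using B \<rho>.finite_measure_compl[of B] by (simp add: sets sp)
    ultimately show ?case
      using closed[of UNIV] compl.IH by (simp add: Compl_eq_Diff_UNIV)
  next
    case (union B)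
    then have B: "B i \<in> sets borel" for i by (auto simp: borel_eq_closed)
    have U: "(LINT u:(\<Union>i. B i)|\<sigma>. G u) = (\<Sum>i. (LINT u:(B i)|\<sigma>. G u))"
      using union.hyps(1) B by (intro lebesgue_integral_countable_add int) (auto simp: sets disjoint_family_on_def)
    have "(\<lambda>i. measure \<rho> (B i)) sums measure \<rho> (\<Union>i. B i)"
      using union.hyps(1) B by (intro \<rho>.finite_measure_UNION) (auto simp: sets)
    then have "(\<lambda>i. complex_of_real (measure \<rho> (B i))) sums of_real (measure \<rho> (\<Union>i. B i))"
      by (rule sums_of_real)
    then show ?case
      unfolding U union.IH by (rule sums_unique[symmetric])
  next
    case empty
    show ?case by (simp add: set_lebesgue_integral_def)
  qed (use closed in simp)
qed

lemma integral_circle_character: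
  "(LINT t|lborel. indicator {-pi..pi} t *\<^sub>R cis (of_int m * t)) = (if m = 0 then 2 * of_real pi else 0)"
proof (cases "m = 0")
  case True
  then show ?thesis
    by (simp add: scaleR_conv_of_real)
next
  case False
  have "(LINT t|lborel. indicator {-pi..pi} t *\<^sub>R cis (of_int m * t))
      = cis (of_int m * pi) / (\<i> * of_int m) - cis (of_int m * - pi) / (\<i> * of_int m)"
  proof (rule integral_FTC_atLeastAtMost)
    show "((\<lambda>t. cis (of_int m * t) / (\<i> * of_int m)) has_vector_derivative cis (of_int m * t)) (at t within {-pi..pi})" for t
      using False unfolding cis_conv_exp
      by (auto intro!: derivative_eq_intros has_vector_derivative_real_field simp: field_simps)
  qed (auto intro!: continuous_intros)
  also have "cis (of_int m * - pi) = cis (of_int m * pi)"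
    by (simp add: complex_eq_iff sin_times_pi_eq_0)
  finally show ?thesis
    using False by simp
qed

lemma card_shifted_pairs:
  "(\<Sum>j\<in>{0..int n}. \<Sum>l\<in>{0..int n}. of_bool (j - l = k)) = (of_nat (nat (int n + 1 - \<bar>k\<bar>)) :: complex)"
proof -
  have "(\<Sum>j\<in>{0..int n}. \<Sum>l\<in>{0..int n}. of_bool (j - l = k)) 
      = (\<Sum>j\<in>{0..int n}. of_bool (j - k \<in> {0..int n}) :: complex)"
  proof (intro sum.cong refl)
    fix j
    have "(\<Sum>l\<in>{0..int n}. of_bool (j - l = k)) = (\<Sum>l\<in>{0..int n}. if l = j - k then 1 else 0 :: complex)"
      by (intro sum.cong) auto
    then show "(\<Sum>l\<in>{0..int n}. of_bool (j - l = k)) = (of_bool (j - k \<in> {0..int n}) :: complex)"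
      by simp
  qed
  also have "\<dots> = of_nat (card ({0..int n} \<inter> {j. j - k \<in> {0..int n}}))"
    by (simp add: of_bool_def sum.If_cases)
  also have "{0..int n} \<inter> {j. j - k \<in> {0..int n}} = {max 0 k..min (int n) (int n + k)}"
    by auto
  also have "card \<dots> = nat (int n + 1 - \<bar>k\<bar>)"
    by (auto intro: arg_cong[of _ _ nat])
  finally show ?thesis .
qed

text \<open>The Cesaro means of the Fourier series with coefficients \<open>a\<close> are nonnegative, as each is the
value of the positive definite form at the vector of the numbers \<open>cis (- j * t)\<close>. They are
densities of probability measures on \<open>{-pi..pi}\<close> whose \<open>k\<close>-th Fourier coefficient tends to
\<open>a k\<close>, and by Helly's theorem a subsequence converges weakly.\<close>

proposition herglotz_normalized:
  fixes a :: "int \<Rightarrow> complex"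
  assumes psd: "\<And>F c. finite F \<Longrightarrow> (\<Sum>j\<in>F. \<Sum>l\<in>F. c j * cnj (c l) * a (j - l)) \<in> \<real>\<^sub>\<ge>\<^sub>0"
    and a0: "a 0 = 1"
  shows "\<exists>M. real_distribution M \<and> (\<forall>k. (LINT t|M. cis (of_int k * t)) = a k)"
proof -
  define S where "S n t = (\<Sum>j\<in>{0..int n}. \<Sum>l\<in>{0..int n}. cis (- of_int j * t) * cnj (cis (- of_int l * t)) * a (j - l))"
    for n t
  define d where "d n t = indicator {-pi..pi} t * (Re (S n t) / (2 * pi * real (Suc n)))" for n t
  have S: "S n t \<in> \<real>\<^sub>\<ge>\<^sub>0" for n t
    unfolding S_def by (rule psd) simp
  then have S_Re: "S n t = of_real (Re (S n t))" "Re (S n t) \<ge> 0" for n t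
    using S[of n t] by (auto simp: complex_nonneg_Reals_iff complex_eq_iff)
  have S_char: "S n t = (\<Sum>j\<in>{0..int n}. \<Sum>l\<in>{0..int n}. cis (of_int (l - j) * t) * a (j - l))" for n t
    by (simp add: S_def cis_cnj cis_mult algebra_simps)
  have cont: "continuous_on UNIV (S n)" for n
    unfolding S_char[abs_def] by (intro continuous_intros)
  have [measurable]: "S n \<in> borel_measurable borel" for n
    using cont by (rule borel_measurable_continuous_onI)
  have d_nonneg: "d n t \<ge> 0" for n t
    using S_Re by (simp add: d_def)
  have d_meas [measurable]: "d n \<in> borel_measurable borel" for n
    unfolding d_def by measurable
  have moment: "(LINT t|lborel. d n t *\<^sub>R cis (of_int k * t)) = a k * of_nat (nat (int n + 1 - \<bar>k\<bar>)) / of_nat (Suc n)"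
    for n k
  proof -
    have *: "d n t *\<^sub>R cis (of_int k * t) = (\<Sum>j\<in>{0..int n}. \<Sum>l\<in>{0..int n}.
        a (j - l) / (2 * of_real pi * of_nat (Suc n)) * (indicator {-pi..pi} t *\<^sub>R cis (of_int (k - (j - l)) * t)))" for t
    proof -
      have "d n t *\<^sub>R cis (of_int k * t)
          = indicator {-pi..pi} t *\<^sub>R (S n t / (2 * of_real pi * of_nat (Suc n)) * cis (of_int k * t))"
        by (subst S_Re) (simp add: d_def scaleR_conv_of_real)
      also have "\<dots> = (\<Sum>j\<in>{0..int n}. \<Sum>l\<in>{0..int n}.
          a (j - l) / (2 * of_real pi * of_nat (Suc n)) *
          (indicator {-pi..pi} t *\<^sub>R (cis (of_int (l - j) * t) * cis (of_int k * t))))"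
        unfolding S_char
        by (simp add: sum_divide_distrib sum_distrib_right sum_distrib_left mult_ac scaleR_conv_of_real)
      also have "\<dots> = (\<Sum>j\<in>{0..int n}. \<Sum>l\<in>{0..int n}.
          a (j - l) / (2 * of_real pi * of_nat (Suc n)) * (indicator {-pi..pi} t *\<^sub>R cis (of_int (k - (j - l)) * t)))"
        unfolding cis_mult by (intro sum.cong refl arg_cong2[of _ _ _ _ "(*)"] arg_cong2[of _ _ _ _ scaleR] arg_cong[of _ _ cis])
          (simp add: algebra_simps)
      finally show ?thesis .
    qed
    have int: "integrable lborel (\<lambda>t. indicator {-pi..pi} t *\<^sub>R cis (of_int m * t))" for m
      using borel_integrable_atLeastAtMost'[of "-pi" pi "\<lambda>t. cis (of_int m * t)"]
      unfolding set_integrable_def by (simp add: continuous_intros)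
    have "(LINT t|lborel. d n t *\<^sub>R cis (of_int k * t)) = (\<Sum>j\<in>{0..int n}. \<Sum>l\<in>{0..int n}.
        a (j - l) / (2 * of_real pi * of_nat (Suc n)) * (if k - (j - l) = 0 then 2 * of_real pi else 0))"
      unfolding *
      by (simp only: Bochner_Integration.integral_sum Bochner_Integration.integrable_sum integrable_mult_right int
          integral_mult_right_zero integral_circle_character)
    also have "\<dots> = (\<Sum>j\<in>{0..int n}. \<Sum>l\<in>{0..int n}. a k / of_nat (Suc n) * of_bool (j - l = k))"
      by (intro sum.cong refl) auto
    also have "\<dots> = a k / of_nat (Suc n) * of_nat (nat (int n + 1 - \<bar>k\<bar>))"
      by (simp only: flip: sum_distrib_left card_shifted_pairs)
    finally show ?thesis by simp
  qed
  have d_int: "integrable lborel (d n)" for n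
  proof -
    have "set_integrable lborel {-pi..pi} (\<lambda>t. Re (S n t) / (2 * pi * real (Suc n)))"
      using cont by (intro borel_integrable_atLeastAtMost' continuous_intros) (auto intro: continuous_on_subset)
    then show ?thesis
      by (simp add: set_integrable_def d_def[abs_def])
  qed
  define \<mu> where "\<mu> n = density lborel (\<lambda>t. ennreal (d n t))" for n
  have "complex_of_real (LINT t|lborel. d n t) = 1" for n
    using moment[of n 0] by (simp add: scaleR_conv_of_real a0 nat_add_distrib flip: of_nat_Suc) 
  then have mass: "(LINT t|lborel. d n t) = 1" for n
    by (simp only: of_real_eq_1_iff)
  have nn: "(\<integral>\<^sup>+t. ennreal (d n t) \<partial>lborel) = 1" for n
    using nn_integral_eq_integral[OF d_int, of n] d_nonneg mass by simp
  have rd: "real_distribution (\<mu> n)" for n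
  proof (intro real_distribution.intro real_distribution_axioms.intro prob_spaceI)
    show "emeasure (\<mu> n) (space (\<mu> n)) = 1"
      using nn by (simp add: \<mu>_def emeasure_density)
  qed (simp add: \<mu>_def)
  have "tight \<mu>"
    unfolding tight_def
  proof (intro conjI allI impI rd)
    fix e :: real assume "e > 0"
    \<comment> \<open>A half-open interval containing \<open>{-pi..pi}\<close>, outside of which the densities vanish.\<close>
    have "emeasure (\<mu> n) {-4<..4} = 1" for n
    proof -
      have "emeasure (\<mu> n) {-4<..4} = (\<integral>\<^sup>+t. ennreal (d n t) * indicator {-4<..4} t \<partial>lborel)"
        by (simp add: \<mu>_def emeasure_density)
      also have "\<dots> = (\<integral>\<^sup>+t. ennreal (d n t) \<partial>lborel)"
        using pi_less_4 by (intro nn_integral_cong) (auto simp: d_def indicator_def)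
      finally show ?thesis by (simp add: nn)
    qed
    then show "\<exists>a b. a < b \<and> (\<forall>n. 1 - e < measure (\<mu> n) {a<..b})"
      using \<open>e > 0\<close> by (intro exI[of _ "-4"] exI[of _ 4]) (simp add: measure_def)
  qed
  then obtain r M where r: "strict_mono r" and M: "real_distribution M" and weak: "weak_conv_m (\<mu> \<circ> r) M"
    using tight_imp_convergent_subsubsequence[of \<mu> id] by (auto simp: strict_mono_id)
  have "(LINT t|M. cis (of_int k * t)) = a k" for k
  proof -
    have lim: "(\<lambda>n. LINT t|(\<mu> \<circ> r) n. cis (of_int k * t)) \<longlonglongrightarrow> (LINT t|M. cis (of_int k * t))"
    proof (rule weak_conv_imp_integral_bdd_continuous_conv[where B = 1])
      show "isCont (\<lambda>t. cis (of_int k * t)) t" for t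
        unfolding cis_conv_exp by (intro continuous_intros)
    qed (use rd M weak in \<open>auto simp: o_def\<close>)
    have "(LINT t|\<mu> n. cis (of_int k * t)) = a k * of_nat (nat (int n + 1 - \<bar>k\<bar>)) / of_nat (Suc n)" for n
    proof -
      have "(\<lambda>t. cis (of_int k * t)) \<in> borel_measurable borel"
        by (intro borel_measurable_continuous_onI continuous_intros)
      then show ?thesis
        unfolding \<mu>_def using d_nonneg moment by (subst integral_density) auto
    qed
    moreover have "(\<lambda>n. a k * of_nat (nat (int n + 1 - \<bar>k\<bar>)) / of_nat (Suc n)) \<longlonglongrightarrow> a k"
    proof -
      have "(\<lambda>n. a k * of_real (1 - of_int \<bar>k\<bar> * inverse (real (Suc n)))) \<longlonglongrightarrow> a k * of_real (1 - of_int \<bar>k\<bar> * 0)"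
        by (intro tendsto_intros LIMSEQ_inverse_real_of_nat)
      moreover have "\<forall>\<^sub>F n in sequentially. a k * of_real (1 - of_int \<bar>k\<bar> * inverse (real (Suc n)))
          = a k * of_nat (nat (int n + 1 - \<bar>k\<bar>)) / of_nat (Suc n)"
        using eventually_ge_at_top[of "nat \<bar>k\<bar>"]
      proof eventually_elim
        case (elim n)
        then have count: "of_nat (nat (int n + 1 - \<bar>k\<bar>)) = (of_nat (Suc n) - of_int \<bar>k\<bar> :: complex)"
          by (subst of_nat_nat) auto
        show ?case
          unfolding count by (simp add: field_simps del: of_int_abs of_nat_Suc)
      qed
      ultimately show ?thesis
        by (simp add: tendsto_cong)
    qed
    ultimately have "(\<lambda>n. LINT t|\<mu> n. cis (of_int k * t)) \<longlonglongrightarrow> a k"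
      by simp
    from LIMSEQ_subseq_LIMSEQ[OF this r] lim show ?thesis
      unfolding o_def by (rule LIMSEQ_unique[rotated])
  qed
  with M show ?thesis by blast
qed

text \<open>The case \<open>a 0 = 0\<close> is separate because the approximating measures are normalized to probability
measures; in this case \<open>a\<close> vanishes by the Cauchy-Schwarz inequality.\<close>

proposition herglotz:
  fixes a :: "int \<Rightarrow> complex"
  assumes psd: "\<And>F c. finite F \<Longrightarrow> (\<Sum>j\<in>F. \<Sum>l\<in>F. c j * cnj (c l) * a (j - l)) \<in> \<real>\<^sub>\<ge>\<^sub>0"
  shows "\<exists>\<rho>. circle_measure \<rho> \<and> (\<forall>k. (LINT u|\<rho>. u powi k) = a k)"
proof (cases "a 0 = 0")
  case True
  have "a k = 0" for k
  proof -
    have "(\<Sum>j\<in>{0, - k}. of_bool (j = 0) * a (j - - k)) = 0"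
    proof (rule psd_null_vector)
      have "(\<Sum>j\<in>{0, - k}. \<Sum>l\<in>{0, - k}. of_bool (j = 0) * cnj (of_bool (l = 0)) * a (j - l)) 
          = (\<Sum>j\<in>{0, - k}. \<Sum>l\<in>{0, - k}. 0)"
        by (intro sum.cong refl) (auto simp: True)
      then show "(\<Sum>j\<in>{0, - k}. \<Sum>l\<in>{0, - k}. of_bool (j = 0) * cnj (of_bool (l = 0)) * a (j - l)) = 0"
        by simp
    qed (use psd in auto)
    then show ?thesis
      by (cases "k = 0") (auto simp: True)
  qed
  then show ?thesis
    by (intro exI[of _ "null_measure borel"]) (auto simp: circle_measure_def intro!: finite_measureI AE_I[of _ _ UNIV])
next
  case False
  define b where "b = Re (a 0)"
  have "a 0 \<in> \<real>\<^sub>\<ge>\<^sub>0"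
    using psd[of "{0}" "\<lambda>_. 1"] by simp
  with False have b: "b > 0" "a 0 = of_real b"
    by (auto simp: complex_nonneg_Reals_iff b_def complex_eq_iff)
  have "\<exists>M. real_distribution M \<and> (\<forall>k. (LINT t|M. cis (of_int k * t)) = a k / of_real b)"
  proof (rule herglotz_normalized)
    fix F :: "int set" and c
    assume "finite F"
    have "(\<Sum>j\<in>F. \<Sum>l\<in>F. c j * cnj (c l) * (a (j - l) / of_real b))
        = (\<Sum>j\<in>F. \<Sum>l\<in>F. c j * cnj (c l) * a (j - l)) * of_real (1 / b)"
      by (simp add: sum_distrib_right sum_divide_distrib)
    also have "\<dots> \<in> \<real>\<^sub>\<ge>\<^sub>0"
      using b by (intro nonneg_Reals_mult_I psd \<open>finite F\<close>) auto
    finally show "(\<Sum>j\<in>F. \<Sum>l\<in>F. c j * cnj (c l) * (a (j - l) / of_real b)) \<in> \<real>\<^sub>\<ge>\<^sub>0" .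
  qed (use b in auto)
  then obtain M where M: "real_distribution M" "\<And>k. (LINT t|M. cis (of_int k * t)) = a k / of_real b"
    by blast
  interpret real_distribution M by fact
  define \<rho> where "\<rho> = density (distr M borel cis) (\<lambda>_. ennreal b)"
  have [measurable]: "cis \<in> borel_measurable borel"
    by (intro borel_measurable_continuous_onI continuous_intros)
  have "circle_measure \<rho>"
    unfolding circle_measure_def
  proof (intro conjI finite_measureI)
    show "emeasure \<rho> (space \<rho>) \<noteq> \<infinity>"
      by (simp add: \<rho>_def emeasure_density nn_integral_cmult emeasure_distr ennreal_mult_eq_top_iff)
    show "AE u in \<rho>. norm u = 1"
      unfolding \<rho>_def by (subst AE_density, simp, subst AE_distr_iff) auto
  qed (simp add: \<rho>_def)
  moreover have "(LINT u|\<rho>. u powi k) = a k" for k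
  proof -
    have "(LINT u|\<rho>. u powi k) = (LINT u|distr M borel cis. b *\<^sub>R (u powi k))"
      unfolding \<rho>_def using b by (subst integral_density) auto
    also have "\<dots> = (LINT t|M. b *\<^sub>R cis t powi k)"
      by (subst integral_distr) auto
    also have "\<dots> = b *\<^sub>R (LINT t|M. cis (of_int k * t))"
      by (simp add: cis_power_int mult.commute)
    finally show ?thesis
      using b by (simp add: M scaleR_conv_of_real)
  qed
  ultimately show ?thesis by blast
qed

section \<open>Disintegration of positive definite sequences over the circle\<close>

text \<open>The sum of the given measures with weights that make it converge.\<close>

lemma dominating_measure:
  fixes \<nu> :: "nat \<Rightarrow> 'a measure"
  assumes fin: "\<And>n. finite_measure (\<nu> n)" and sets: "\<And>n. sets (\<nu> n) = sets M"
  shows "\<exists>\<sigma>. finite_measure \<sigma> \<and> sets \<sigma> = sets M \<and>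
    (\<forall>A\<in>sets M. emeasure \<sigma> A = 0 \<longleftrightarrow> (\<forall>n. emeasure (\<nu> n) A = 0))"
proof -
  \<comment> \<open>The total mass of the weighted sum is at most the geometric series.\<close>
  define w where "w n = (1/2) ^ n / (1 + measure (\<nu> n) (space M))" for n
  have w: "w n > 0" for n
    by (auto simp: w_def add_pos_nonneg)
  define m where "m A = (\<integral>\<^sup>+n. ennreal (w n) * emeasure (\<nu> n) A \<partial>count_space UNIV)" for A
  define \<sigma> where "\<sigma> = measure_of (space M) (sets M) m"
  have sets_\<sigma>: "sets \<sigma> = sets M"
    by (simp add: \<sigma>_def)
  have m: "emeasure \<sigma> A = m A" if "A \<in> sets M" for A
    unfolding \<sigma>_def
  proof (rule emeasure_measure_of_sigma)
    show "positive (sets M) m"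
      by (simp add: positive_def m_def)
    show "countably_additive (sets M) m"
      unfolding countably_additive_def
    proof (intro allI impI)
      fix A :: "nat \<Rightarrow> 'a set"
      assume A: "range A \<subseteq> sets M" "disjoint_family A"
      have "(\<Sum>i. m (A i)) = (\<integral>\<^sup>+n. (\<Sum>i. ennreal (w n) * emeasure (\<nu> n) (A i)) \<partial>count_space UNIV)"
        unfolding m_def by (rule nn_integral_suminf[symmetric]) auto
      also have "\<dots> = (\<integral>\<^sup>+n. ennreal (w n) * emeasure (\<nu> n) (\<Union>i. A i) \<partial>count_space UNIV)"
        using A by (intro nn_integral_cong) (simp add: suminf_emeasure sets)
      finally show "(\<Sum>i. m (A i)) = m (\<Union> (range A))"
        by (simp add: m_def)
    qed
  qed (use that sets.sigma_algebra_axioms in auto)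
  have "m (space M) \<le> (\<integral>\<^sup>+n. ennreal ((1/2) ^ n) \<partial>count_space UNIV)"
    unfolding m_def
  proof (intro nn_integral_mono)
    fix n
    interpret finite_measure "\<nu> n" by (rule fin)
    have "ennreal (w n) * emeasure (\<nu> n) (space M) = ennreal (w n * measure (\<nu> n) (space M))"
      using w[of n] by (simp add: emeasure_eq_measure ennreal_mult)
    also have "\<dots> \<le> ennreal ((1/2) ^ n)"
      by (intro ennreal_leI) (simp add: w_def field_simps add_pos_nonneg)
    finally show "ennreal (w n) * emeasure (\<nu> n) (space M) \<le> ennreal ((1/2) ^ n)" .
  qed
  also have "\<dots> = ennreal (\<Sum>n. (1/2) ^ n)"
    by (subst nn_integral_count_space_nat) (auto intro!: suminf_ennreal2)
  finally have "m (space M) < \<infinity>"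
    by (auto simp: top_unique less_top[symmetric])
  then have "finite_measure \<sigma>"
    by (intro finite_measureI) (simp add: m sets_eq_imp_space_eq[OF sets_\<sigma>])
  moreover have "emeasure \<sigma> A = 0 \<longleftrightarrow> (\<forall>n. emeasure (\<nu> n) A = 0)" if "A \<in> sets M" for A
  proof -
    have "ennreal (w n) \<noteq> 0" for n
      using w[of n] by simp
    with that show ?thesis
      by (simp add: m m_def nn_integral_0_iff_AE AE_count_space)
  qed
  ultimately show ?thesis
    using sets_\<sigma> by blast
qed

lemma finite_measure_real_density:
  assumes "finite_measure \<sigma>" "finite_measure \<rho>" and ac: "absolutely_continuous \<sigma> \<rho>" "sets \<rho> = sets \<sigma>"
  shows "\<exists>d. integrable \<sigma> d \<and> (\<forall>x. d x \<ge> 0) \<and> \<rho> = density \<sigma> (\<lambda>x. ennreal (d x))"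
proof -
  interpret \<sigma>: finite_measure \<sigma> by fact
  interpret \<rho>: finite_measure \<rho> by fact
  define d where "d x = enn2real (RN_deriv \<sigma> \<rho> x)" for x
  have [measurable]: "d \<in> borel_measurable \<sigma>"
    unfolding d_def[abs_def] by measurable
  have "\<rho> = density \<sigma> (RN_deriv \<sigma> \<rho>)"
    using ac by (simp add: \<sigma>.density_RN_deriv)
  also have "\<dots> = density \<sigma> (\<lambda>x. ennreal (d x))"
    using \<sigma>.RN_deriv_finite[OF \<rho>.sigma_finite_measure_axioms ac]
    by (intro density_cong) (auto simp: d_def top.not_eq_extremum elim!: eventually_mono)
  finally have \<rho>: "\<rho> = density \<sigma> (\<lambda>x. ennreal (d x))" .
  have "integrable \<rho> (\<lambda>_. 1 :: real)"
    by simp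
  then have "integrable \<sigma> d"
    by (subst (asm) \<rho>) (simp add: integrable_density d_def[abs_def])
  with \<rho> show ?thesis
    by (intro exI[of _ d]) (simp add: d_def)
qed

text \<open>The exponent of \<open>mono_zz k z * cnj (mono_zz l z)\<close>.\<close>

definition star_add :: "int \<times> int \<Rightarrow> int \<times> int \<Rightarrow> int \<times> int" where
  "star_add k l = (fst k + snd l, snd k + fst l)"

lemma pos_def_plus_sum:
  assumes "pos_def_plus \<Gamma>" "finite F" "F \<subseteq> NN_plus"
  shows "(\<Sum>k\<in>F. \<Sum>l\<in>F. c k * cnj (c l) * \<Gamma> (star_add k l)) \<in> \<real>\<^sub>\<ge>\<^sub>0"
proof -
  define c' where "c' k = (if k \<in> F then c k else 0)" for k
  define S where "S = {k \<in> NN_plus. c' k \<noteq> 0}"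
  have S: "S \<subseteq> F"
    by (auto simp: S_def c'_def split: if_splits)
  have zero: "c k = 0" if "k \<in> F - S" for k
    using that assms(3) by (auto simp: S_def c'_def)
  have "finite S"
    using S assms(2) finite_subset by blast
  then have "(\<Sum>k\<in>S. \<Sum>l\<in>S. c' k * cnj (c' l) * \<Gamma> (star_add k l)) \<in> \<real>\<^sub>\<ge>\<^sub>0"
    using assms(1) unfolding pos_def_plus_def S_def star_add_def by (simp add: split_beta)
  also have "(\<Sum>k\<in>S. \<Sum>l\<in>S. c' k * cnj (c' l) * \<Gamma> (star_add k l))
      = (\<Sum>k\<in>F. \<Sum>l\<in>S. c' k * cnj (c' l) * \<Gamma> (star_add k l))"
    using S zero assms(2) by (intro sum.mono_neutral_left) (auto simp: c'_def)
  also have "\<dots> = (\<Sum>k\<in>F. \<Sum>l\<in>F. c' k * cnj (c' l) * \<Gamma> (star_add k l))"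
    using S zero assms(2) by (intro sum.cong refl sum.mono_neutral_left) (auto simp: c'_def)
  also have "\<dots> = (\<Sum>k\<in>F. \<Sum>l\<in>F. c k * cnj (c l) * \<Gamma> (star_add k l))"
    by (simp add: c'_def)
  finally show ?thesis .
qed

text \<open>The value of the functional at \<open>u powi k * F * cnj F\<close> for \<open>F = (\<Sum>j\<le>N. f j * cnj z ^ j)\<close>; the
factor \<open>u ^ l\<close>, which shifts \<open>k\<close>, arises since \<open>z = u * cnj z\<close>.\<close>

definition fiber_form :: "(int \<times> int \<Rightarrow> complex) \<Rightarrow> nat \<Rightarrow> (nat \<Rightarrow> complex) \<Rightarrow> int \<Rightarrow> complex" where
  "fiber_form \<Gamma> N f k = (\<Sum>j\<le>N. \<Sum>l\<le>N. f j * cnj (f l) * \<Gamma> (k + int l, int j - k))"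

text \<open>A trigonometric polynomial \<open>Q\<close> with coefficients \<open>c\<close> gives the sum the meaning of the
functional at \<open>\<bar>Q * F\<bar>\<^sup>2\<close>. As a function of \<open>k\<close> the form \<open>fiber_form \<Gamma> N f k\<close> thus satisfies the
hypothesis of the theorem of Herglotz.\<close>

lemma fiber_form_psd:
  assumes "pos_def_plus \<Gamma>" "finite J"
  shows "(\<Sum>k\<in>J. \<Sum>k'\<in>J. c k * cnj (c k') * fiber_form \<Gamma> N f (k - k')) \<in> \<real>\<^sub>\<ge>\<^sub>0"
proof -
  define e where "e = (\<lambda>(k, j). (k, int j - k))"
  define h where "h = (\<lambda>(m, n). c m * f (nat (m + n)))"
  have inj: "inj_on e (J \<times> {..N})"
    by (auto simp: inj_on_def e_def)
  have "(\<Sum>x\<in>e ` (J \<times> {..N}). \<Sum>y\<in>e ` (J \<times> {..N}). h x * cnj (h y) * \<Gamma> (star_add x y)) \<in> \<real>\<^sub>\<ge>\<^sub>0"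
    using assms by (intro pos_def_plus_sum) (auto simp: e_def NN_plus_def)
  also have "(\<Sum>x\<in>e ` (J \<times> {..N}). \<Sum>y\<in>e ` (J \<times> {..N}). h x * cnj (h y) * \<Gamma> (star_add x y))
      = (\<Sum>k\<in>J. \<Sum>j\<le>N. \<Sum>k'\<in>J. \<Sum>l\<le>N. c k * f j * cnj (c k' * f l) * \<Gamma> (k - k' + int l, int j - (k - k')))"
    unfolding sum.reindex[OF inj]
    by (simp add: sum.cartesian_product' e_def h_def star_add_def algebra_simps)
  also have "\<dots> = (\<Sum>k\<in>J. \<Sum>k'\<in>J. \<Sum>j\<le>N. \<Sum>l\<le>N. c k * f j * cnj (c k' * f l) * \<Gamma> (k - k' + int l, int j - (k - k')))"
    by (intro sum.cong refl sum.swap)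
  also have "\<dots> = (\<Sum>k\<in>J. \<Sum>k'\<in>J. c k * cnj (c k') * fiber_form \<Gamma> N f (k - k'))"
    by (simp add: fiber_form_def sum_distrib_left mult_ac)
  finally show ?thesis .
qed

text \<open>Polarization of the product of \<open>1\<close> and \<open>cnj z ^ j\<close>, using the absolute squares of
\<open>1 + \<i> ^ e * cnj z ^ j\<close>. It also holds for \<open>j = 0\<close>, where the two basis vectors coincide.\<close>

lemma fiber_form_polarization:
  "4 * \<Gamma> (k, int j - k) = (\<Sum>e<4. cnj (\<i> ^ e) *
     fiber_form \<Gamma> j (\<lambda>i. of_bool (i = 0) + \<i> ^ e * of_bool (i = j)) k)"
proof -
  have pick: "(\<Sum>i\<le>j. (of_bool (i = 0) + c * of_bool (i = j)) * X i) = X 0 + c * X j" for c and X :: "nat \<Rightarrow> complex"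
  proof -
    have "(\<Sum>i\<le>j. (of_bool (i = 0) + c * of_bool (i = j)) * X i)
        = (\<Sum>i\<le>j. if i = 0 then X 0 else 0) + (\<Sum>i\<le>j. if i = j then c * X j else 0)"
      unfolding sum.distrib[symmetric] by (intro sum.cong) (auto simp: distrib_right)
    then show ?thesis by simp
  qed
  have "fiber_form \<Gamma> j (\<lambda>i. of_bool (i = 0) + c * of_bool (i = j)) k
      = \<Gamma> (k, - k) + cnj c * \<Gamma> (k + int j, - k) + c * (\<Gamma> (k, int j - k) + cnj c * \<Gamma> (k + int j, int j - k))" for c
  proof -
    have "fiber_form \<Gamma> j (\<lambda>i. of_bool (i = 0) + c * of_bool (i = j)) k
      = (\<Sum>i\<le>j. (of_bool (i = 0) + c * of_bool (i = j)) *
          (\<Sum>l\<le>j. (of_bool (l = 0) + cnj c * of_bool (l = j)) * \<Gamma> (k + int l, int i - k)))"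
      by (simp add: fiber_form_def sum_distrib_left mult.assoc of_bool_def if_distrib[of cnj] cong: if_cong)
    then show ?thesis
      unfolding pick by simp
  qed
  then show ?thesis
    by (simp add: eval_nat_numeral lessThan_Suc algebra_simps)
qed

text \<open>Polarization writes \<open>\<Gamma> (k, j - k)\<close> as a combination of the Fourier coefficients of four
positive measures for each \<open>j\<close>. Countably many measures are involved, so a single finite
measure dominates them all, and the Radon-Nikodym theorem gives the densities.\<close>

proposition pos_def_disintegration:
  assumes \<Gamma>: "pos_def_plus \<Gamma>"
  shows "\<exists>\<sigma> (g :: nat \<Rightarrow> complex \<Rightarrow> complex). circle_measure \<sigma> \<and> (\<forall>j. integrable \<sigma> (g j)) \<and>
    (\<forall>k j. \<Gamma> (k, int j - k) = (LINT u|\<sigma>. u powi k * g j u))"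
proof -
  define T where "T j e = fiber_form \<Gamma> j (\<lambda>i. of_bool (i = 0) + \<i> ^ e * of_bool (i = j))" for j e :: nat
  have "\<exists>\<rho>. circle_measure \<rho> \<and> (\<forall>k. (LINT u|\<rho>. u powi k) = T j e k)" for j e
    unfolding T_def by (intro herglotz fiber_form_psd[OF \<Gamma>])
  then obtain \<rho> where \<rho>: "\<And>j e. circle_measure (\<rho> j e)" "\<And>j e k. (LINT u|\<rho> j e. u powi k) = T j e k"
    by metis
  have fin: "finite_measure (\<rho> j e)" and sets_\<rho>: "sets (\<rho> j e) = sets borel" for j e
    using \<rho>(1) by (auto simp: circle_measure_def)
  obtain \<sigma> where \<sigma>: "finite_measure \<sigma>" "sets \<sigma> = sets borel"
    and null: "\<And>A. A \<in> sets borel \<Longrightarrow> emeasure \<sigma> A = 0 \<longleftrightarrow> (\<forall>n. emeasure (\<rho> (n div 4) (n mod 4)) A = 0)"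
    using dominating_measure[of "\<lambda>n. \<rho> (n div 4) (n mod 4)" borel] fin sets_\<rho> by metis
  have sp: "space \<sigma> = UNIV"
    using sets_eq_imp_space_eq[OF \<sigma>(2)] by simp
  have "emeasure (\<rho> j e) {u. norm u \<noteq> 1} = 0" for j e
  proof -
    have "AE u in \<rho> j e. norm u = 1"
      using \<rho>(1) by (auto simp: circle_measure_def)
    then show ?thesis
      using sets_eq_imp_space_eq[OF sets_\<rho>] by (subst (asm) AE_iff_measurable) (auto simp: sets_\<rho>)
  qed
  then have "emeasure \<sigma> {u. norm u \<noteq> 1} = 0"
    by (subst null) auto
  then have "AE u in \<sigma>. norm u = 1"
    by (intro AE_I[of _ _ "{u. norm u \<noteq> 1}"]) (simp_all add: sp \<sigma>(2))
  with \<sigma> have circle: "circle_measure \<sigma>"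
    by (simp add: circle_measure_def)
  have ac: "absolutely_continuous \<sigma> (\<rho> j e)" if "e < 4" for j e
    unfolding absolutely_continuous_def
  proof
    fix A assume A: "A \<in> null_sets \<sigma>"
    \<comment> \<open>The pair \<open>(j, e)\<close> with \<open>e < 4\<close> has the index \<open>4 * j + e\<close> in the dominated family.\<close>
    then have "emeasure (\<rho> ((4 * j + e) div 4) ((4 * j + e) mod 4)) A = 0"
      using null[of A] unfolding null_sets_def \<sigma>(2) by blast
    moreover have "(4 * j + e) div 4 = j" "(4 * j + e) mod 4 = e"
      using that by simp_all
    ultimately show "A \<in> null_sets (\<rho> j e)"
      using A unfolding null_sets_def \<sigma>(2) sets_\<rho> by simp
  qed
  have ex_density: "\<exists>d. integrable \<sigma> d \<and> (\<forall>x. d x \<ge> 0) \<and> \<rho> j e = density \<sigma> (\<lambda>x. ennreal (d x))" if "e < 4" for j e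
    using that by (intro finite_measure_real_density fin ac) (simp_all add: \<sigma> sets_\<rho>)
  define d where "d j e = (SOME d. integrable \<sigma> d \<and> (\<forall>x. d x \<ge> 0) \<and> \<rho> j e = density \<sigma> (\<lambda>x. ennreal (d x)))"
    for j e
  have d: "integrable \<sigma> (d j e)" "d j e x \<ge> 0" "\<rho> j e = density \<sigma> (\<lambda>x. ennreal (d j e x))"
    if "e < 4" for j e x
    using someI_ex[OF ex_density[OF that, of j]] unfolding d_def[symmetric] by blast+
  define g where "g j u = (\<Sum>e<4. cnj (\<i> ^ e) / 4 * of_real (d j e u))" for j u
  have int: "integrable \<sigma> (\<lambda>u. cnj (\<i> ^ e) / 4 * of_real (d j e u))" if "e < 4" for e j
    using d(1)[OF that] by simp
  have "integrable \<sigma> (g j)" for j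
    unfolding g_def using int by (intro Bochner_Integration.integrable_sum) auto
  moreover have "\<Gamma> (k, int j - k) = (LINT u|\<sigma>. u powi k * g j u)" for k j
  proof -
    have T: "T j e k = (LINT u|\<sigma>. u powi k * of_real (d j e u))" if "e < 4" for e
    proof -
      have [measurable_cong]: "sets \<sigma> = sets borel" by fact
      have [measurable]: "d j e \<in> borel_measurable \<sigma>"
        using d(1)[OF that] by auto
      have "(\<lambda>u. u powi k) \<in> borel_measurable \<sigma>"
        by measurable
      then have "(LINT u|\<rho> j e. u powi k) = (LINT u|\<sigma>. d j e u *\<^sub>R u powi k)"
        unfolding d(3)[OF that] using d(2)[OF that] by (subst integral_density) auto
      then show ?thesis
        by (simp add: \<rho>(2) scaleR_conv_of_real mult.commute)
    qed
    have "4 * \<Gamma> (k, int j - k) = (\<Sum>e<4. cnj (\<i> ^ e) * T j e k)"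
      unfolding T_def by (rule fiber_form_polarization)
    also have "\<dots> = (\<Sum>e<4. cnj (\<i> ^ e) * (LINT u|\<sigma>. u powi k * of_real (d j e u)))"
      using T by simp
    finally have "\<Gamma> (k, int j - k) = (\<Sum>e<4. cnj (\<i> ^ e) * (LINT u|\<sigma>. u powi k * of_real (d j e u))) / 4"
      by (simp add: field_simps)
    also have "\<dots> = (\<Sum>e<4. LINT u|\<sigma>. u powi k * (cnj (\<i> ^ e) / 4 * of_real (d j e u)))"
      unfolding sum_divide_distrib
    proof (intro sum.cong refl)
      fix e
      have "(LINT u|\<sigma>. u powi k * (cnj (\<i> ^ e) / 4 * of_real (d j e u)))
          = (LINT u|\<sigma>. cnj (\<i> ^ e) / 4 * (u powi k * of_real (d j e u)))"
        by (simp only: mult.left_commute)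
      also have "\<dots> = cnj (\<i> ^ e) / 4 * (LINT u|\<sigma>. u powi k * of_real (d j e u))"
        by (rule integral_mult_right_zero)
      finally show "cnj (\<i> ^ e) * (LINT u|\<sigma>. u powi k * of_real (d j e u)) / 4
          = (LINT u|\<sigma>. u powi k * (cnj (\<i> ^ e) / 4 * of_real (d j e u)))"
        by (simp only: times_divide_eq_left)
    qed
    also have "\<dots> = (LINT u|\<sigma>. (\<Sum>e<4. u powi k * (cnj (\<i> ^ e) / 4 * of_real (d j e u))))"
      by (intro Bochner_Integration.integral_sum[symmetric] circle_integrable_powi[OF circle] int) simp
    also have "\<dots> = (LINT u|\<sigma>. u powi k * g j u)"
      by (simp only: g_def sum_distrib_left)
    finally show ?thesis .
  qed
  ultimately show ?thesis
    using circle by blast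
qed

text \<open>For fixed coefficients \<open>f\<close> the density has the Fourier coefficients \<open>fiber_form \<Gamma> N f\<close> of a positive
measure, so it is nonnegative almost everywhere. Countably many \<open>f\<close> can be treated simultaneously, and
all others follow by continuity.\<close>

lemma disintegration_fiber_psd:
  assumes \<Gamma>: "pos_def_plus \<Gamma>" and \<sigma>: "circle_measure \<sigma>" and g: "\<And>j. integrable \<sigma> (g j)"
    and dis: "\<And>k j. \<Gamma> (k, int j - k) = (LINT u|\<sigma>. u powi k * g j u)"
  shows "AE u in \<sigma>. \<forall>N f. (\<Sum>j\<le>N. \<Sum>l\<le>N. f j * cnj (f l) * (u powi int l * g (j + l) u)) \<in> \<real>\<^sub>\<ge>\<^sub>0"
proof -
  have sets [measurable_cong]: "sets \<sigma> = sets borel" and "finite_measure \<sigma>" and circle: "AE u in \<sigma>. norm u = 1"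
    using \<sigma> by (auto simp: circle_measure_def)
  then interpret finite_measure \<sigma> by simp
  define G where "G N f u = (\<Sum>j\<le>N. \<Sum>l\<le>N. f j * cnj (f l) * (u powi int l * g (j + l) u))" for N f u
  have [measurable]: "g j \<in> borel_measurable \<sigma>" for j
    using g by auto
  have single: "AE u in \<sigma>. G N f u \<in> \<real>\<^sub>\<ge>\<^sub>0" for N f
  proof -
    have int: "integrable \<sigma> (\<lambda>u. f j * cnj (f l) * (u powi k * g (j + l) u))" for j l k
      using circle_integrable_powi[OF \<sigma> g] by simp
    have G_int: "integrable \<sigma> (G N f)"
      unfolding G_def by (intro Bochner_Integration.integrable_sum int)
    have "(LINT u|\<sigma>. u powi k * G N f u) = fiber_form \<Gamma> N f k" for k
    proof -
      have "(LINT u|\<sigma>. u powi k * G N f u)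
          = (LINT u|\<sigma>. (\<Sum>j\<le>N. \<Sum>l\<le>N. f j * cnj (f l) * (u powi (k + int l) * g (j + l) u)))"
      proof (rule integral_cong_AE)
        show "AE u in \<sigma>. u powi k * G N f u = (\<Sum>j\<le>N. \<Sum>l\<le>N. f j * cnj (f l) * (u powi (k + int l) * g (j + l) u))"
          using circle
        proof eventually_elim
          case (elim u)
          then have "u \<noteq> 0" by auto
          then show ?case
            by (simp add: G_def sum_distrib_left power_int_add mult_ac)
        qed
      qed (unfold G_def, measurable)
      also have "\<dots> = (\<Sum>j\<le>N. \<Sum>l\<le>N. f j * cnj (f l) * (LINT u|\<sigma>. u powi (k + int l) * g (j + l) u))"
        by (simp only: Bochner_Integration.integral_sum Bochner_Integration.integrable_sum int integral_mult_right_zero)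
      also have "\<dots> = fiber_form \<Gamma> N f k"
        by (simp add: fiber_form_def flip: dis)
      finally show ?thesis .
    qed
    moreover obtain \<rho> where \<rho>: "circle_measure \<rho>" "\<And>k. (LINT u|\<rho>. u powi k) = fiber_form \<Gamma> N f k"
      using herglotz[OF fiber_form_psd[OF \<Gamma>]] by blast
    ultimately have "(LINT u:A|\<sigma>. G N f u) = of_real (measure \<rho> A)" if "A \<in> sets borel" for A
      using that by (intro circle_moments_determine_measure[OF \<sigma> \<rho>(1) G_int]) auto
    then show ?thesis
      by (intro averaging_theorem[OF G_int]) (auto simp: sets closed_nonneg_Reals_complex scaleR_conv_of_real)
  qed
  obtain D :: "complex set" where D: "countable D" "\<And>X. open X \<Longrightarrow> X \<noteq> {} \<Longrightarrow> \<exists>d\<in>D. d \<in> X"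
    using countable_dense_exists by blast
  have approx: "\<exists>s. (\<forall>n. s n \<in> D) \<and> s \<longlonglongrightarrow> x" for x
  proof -
    have "x \<in> closure D"
      unfolding closure_approachable using D(2)[of "ball x _"] by (force simp: dist_commute)
    then show ?thesis
      by (simp add: closure_sequential)
  qed
  have "AE u in \<sigma>. \<forall>N. \<forall>f\<in>{..N} \<rightarrow>\<^sub>E D. G N f u \<in> \<real>\<^sub>\<ge>\<^sub>0"
    using single D(1) by (auto simp: AE_all_countable AE_ball_countable countable_PiE)
  then show ?thesis
  proof eventually_elim
    case (elim u)
    show ?case
    proof (intro allI)
      fix N f
      obtain s where s: "\<And>x n. s x n \<in> D" "\<And>x. s x \<longlonglongrightarrow> x"
        using approx by metis
      have "G N (\<lambda>j. s (f j) n) u \<in> \<real>\<^sub>\<ge>\<^sub>0" for n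
      proof -
        have "G N (\<lambda>j\<in>{..N}. s (f j) n) u \<in> \<real>\<^sub>\<ge>\<^sub>0"
          using elim s(1) by auto
        then show ?thesis
          by (simp add: G_def)
      qed
      moreover have "(\<lambda>n. G N (\<lambda>j. s (f j) n) u) \<longlonglongrightarrow> G N f u"
        unfolding G_def using s(2) by (intro tendsto_intros)
      ultimately have "G N f u \<in> \<real>\<^sub>\<ge>\<^sub>0"
        by (rule closed_sequentially[OF closed_nonneg_Reals_complex])
      then show "(\<Sum>j\<le>N. \<Sum>l\<le>N. f j * cnj (f l) * (u powi int l * g (j + l) u)) \<in> \<real>\<^sub>\<ge>\<^sub>0"
        by (simp add: G_def)
    qed
  qed
qed

section \<open>Moments of measures on the plane and the map psi\<close>

lemma mono_zz_star_add:
  assumes "z \<noteq> 0 \<or> k \<in> NN \<and> l \<in> NN"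
  shows "mono_zz (star_add k l) z = mono_zz k z * cnj (mono_zz l z)"
proof -
  have "z powi (m + n) = z powi m * z powi n" if "z \<noteq> 0 \<or> m \<ge> 0 \<and> n \<ge> 0" for z :: complex and m n
  proof (cases "z = 0 \<and> m + n = 0")
    case True
    with that have "m = 0" "n = 0" by auto
    then show ?thesis by simp
  qed (auto simp: power_int_add)
  then show ?thesis
    using assms by (auto simp: mono_zz_def star_add_def NN_def split_beta)
qed

lemma mono_zz_measurable [measurable]: "mono_zz k \<in> borel_measurable borel"
proof -
  have [measurable]: "cnj \<in> borel_measurable borel"
    by (intro borel_measurable_continuous_onI continuous_intros)
  show ?thesis
    unfolding mono_zz_def split_beta by measurable
qed

lemma psi_measurable [measurable]: "psi \<in> borel_measurable borel"
proof -
  have [measurable]: "cnj \<in> borel_measurable borel"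
    by (intro borel_measurable_continuous_onI continuous_intros)
  show ?thesis
    unfolding psi_def[abs_def] by measurable
qed

lemma mono_zz_0: "k \<in> NN \<Longrightarrow> mono_zz k 0 = of_bool (fst k + snd k = 0)"
  by (auto simp: mono_zz_def NN_def power_int_0_left_if)

text \<open>The decomposition of a monomial into a power of the unimodular variable \<open>psi z\<close> and a nonnegative
power of \<open>cnj z\<close> on which the whole argument rests.\<close>

lemma mono_zz_polar:
  assumes "z \<noteq> 0"
  shows "mono_zz (m, n) z = psi z powi m * cnj z powi (m + n)"
  using assms by (simp add: mono_zz_def psi_def power_int_divide_distrib power_int_add)

lemma mono_zz_conj_diff: "z \<noteq> 0 \<Longrightarrow> mono_zz (k, - k) z = psi z powi k"
  by (simp add: mono_zz_polar)

lemma norm_psi: "z \<noteq> 0 \<Longrightarrow> norm (psi z) = 1"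
  by (simp add: psi_def norm_divide)

lemma star_add_NN: "k \<in> NN \<Longrightarrow> l \<in> NN \<Longrightarrow> star_add k l \<in> NN"
  by (auto simp: NN_def star_add_def)

lemma star_add_NN_plus: "k \<in> NN_plus \<Longrightarrow> l \<in> NN_plus \<Longrightarrow> star_add k l \<in> NN_plus"
  by (auto simp: NN_plus_def star_add_def)

lemma NN_subset_NN_plus: "NN \<subseteq> NN_plus"
  by (auto simp: NN_def NN_plus_def)

lemma pos_def_plusI:
  assumes "\<And>F c. finite F \<Longrightarrow> F \<subseteq> NN_plus \<Longrightarrow>
    (\<Sum>k\<in>F. \<Sum>l\<in>F. c k * cnj (c l) * \<Gamma> (star_add k l)) \<in> \<real>\<^sub>\<ge>\<^sub>0"
  shows "pos_def_plus \<Gamma>"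
  unfolding pos_def_plus_def
proof (intro allI impI)
  fix c :: "int \<times> int \<Rightarrow> complex"
  assume fin: "finite {k \<in> NN_plus. c k \<noteq> 0}"
  have "(\<Sum>k\<in>{k \<in> NN_plus. c k \<noteq> 0}. \<Sum>l\<in>{k \<in> NN_plus. c k \<noteq> 0}. c k * cnj (c l) * \<Gamma> (star_add k l)) \<in> \<real>\<^sub>\<ge>\<^sub>0"
    by (rule assms[OF fin]) auto
  then show "(\<Sum>(m, n)\<in>{k \<in> NN_plus. c k \<noteq> 0}. \<Sum>(p, q)\<in>{k \<in> NN_plus. c k \<noteq> 0}.
      c (m, n) * cnj (c (p, q)) * \<Gamma> (m + q, n + p)) \<in> \<real>\<^sub>\<ge>\<^sub>0"
    by (simp add: split_beta star_add_def)
qed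

text \<open>For measures with these moments the form defining positive definiteness is the integral of a square.
The equation between monomials is an assumption almost everywhere because it fails at \<open>0\<close> for negative
exponents, but holds there for exponents in \<open>NN\<close>.\<close>

lemma gram_integral:
  assumes int: "\<And>k l. k \<in> F \<Longrightarrow> l \<in> F \<Longrightarrow> integrable \<mu> (mono_zz (star_add k l))"
    and ae: "AE z in \<mu>. \<forall>k\<in>F. \<forall>l\<in>F. mono_zz (star_add k l) z = mono_zz k z * cnj (mono_zz l z)"
    and sets: "sets \<mu> = sets borel"
  shows "integrable \<mu> (\<lambda>z. (norm (\<Sum>k\<in>F. c k * mono_zz k z))\<^sup>2)" (is ?int)
    and "(\<Sum>k\<in>F. \<Sum>l\<in>F. c k * cnj (c l) * (LINT z|\<mu>. mono_zz (star_add k l) z))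
      = of_real (LINT z|\<mu>. (norm (\<Sum>k\<in>F. c k * mono_zz k z))\<^sup>2)" (is ?eq)
proof -
  note [measurable_cong] = sets
  let ?P = "\<lambda>z. complex_of_real ((norm (\<Sum>k\<in>F. c k * mono_zz k z))\<^sup>2)"
  let ?R = "\<lambda>z. \<Sum>k\<in>F. \<Sum>l\<in>F. c k * cnj (c l) * mono_zz (star_add k l) z"
  have R: "integrable \<mu> ?R"
    using int by (intro Bochner_Integration.integrable_sum integrable_mult_right)
  have eq: "AE z in \<mu>. ?R z = ?P z"
    using ae
  proof eventually_elim
    case (elim z)
    then have "?R z = (\<Sum>k\<in>F. \<Sum>l\<in>F. (c k * mono_zz k z) * cnj (c l * mono_zz l z))"
      by (intro sum.cong refl) auto
    also have "\<dots> = ?P z"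
      by (simp only: complex_norm_square cnj_sum sum_product)
    finally show ?case .
  qed
  have "integrable \<mu> ?P"
    by (rule integrable_cong_AE_imp[OF R _ eq]) measurable
  then show ?int
    by (simp only: complex_of_real_integrable_eq)
  have "(\<Sum>k\<in>F. \<Sum>l\<in>F. c k * cnj (c l) * (LINT z|\<mu>. mono_zz (star_add k l) z)) = (LINT z|\<mu>. ?R z)"
    using int by (simp add: Bochner_Integration.integral_sum Bochner_Integration.integrable_sum)
  also have "\<dots> = (LINT z|\<mu>. ?P z)"
    by (intro integral_cong_AE eq) measurable
  finally show ?eq
    by (simp only: integral_complex_of_real)
qed

lemma repr_measuresD:
  assumes "\<mu> \<in> repr_measures \<gamma>"
  shows "sets \<mu> = sets borel" "finite_measure \<mu>" "\<And>k. k \<in> NN \<Longrightarrow> integrable \<mu> (mono_zz k)"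
    "\<And>k. k \<in> NN \<Longrightarrow> \<gamma> k = (LINT z|\<mu>. mono_zz k z)"
proof -
  show sets: "sets \<mu> = sets borel" and int: "\<And>k. k \<in> NN \<Longrightarrow> integrable \<mu> (mono_zz k)"
    and "\<And>k. k \<in> NN \<Longrightarrow> \<gamma> k = (LINT z|\<mu>. mono_zz k z)"
    using assms by (auto simp: repr_measures_def)
  have "integrable \<mu> (\<lambda>z. 1 :: complex)"
    using int[of "(0, 0)"] by (simp add: NN_def mono_zz_def)
  then show "finite_measure \<mu>"
    by (intro finite_measureI) (simp add: integrable_iff_bounded)
qed

text \<open>The complement of the support is a union of null sets which, by Lindelof's theorem, can be taken
countable.\<close>

lemma msupp_subset_iff:
  fixes \<mu> :: "'a::second_countable_topology measure"
  assumes sets: "sets \<mu> = sets borel" and C: "closed C"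
  shows "msupp \<mu> \<subseteq> C \<longleftrightarrow> emeasure \<mu> (- C) = 0"
proof
  assume "emeasure \<mu> (- C) = 0"
  with C show "msupp \<mu> \<subseteq> C"
    by (auto simp: msupp_def)
next
  assume C_supp: "msupp \<mu> \<subseteq> C"
  define \<F> where "\<F> = {U. open U \<and> emeasure \<mu> U = 0}"
  obtain \<F>' where \<F>': "\<F>' \<subseteq> \<F>" "countable \<F>'" "\<Union>\<F>' = \<Union>\<F>"
    by (rule Lindelof[of \<F>]) (auto simp: \<F>_def)
  have "\<Union>\<F>' \<in> null_sets \<mu>"
    using \<F>'(1,2) by (intro null_sets_UN'[of \<F>' "\<lambda>U. U", simplified]) (auto simp: \<F>_def null_sets_def sets)
  moreover have "- C \<subseteq> \<Union>\<F>'"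
    using C_supp \<F>'(3) by (auto simp: msupp_def \<F>_def)
  moreover have "- C \<in> sets \<mu>"
    using C by (simp add: sets)
  ultimately show "emeasure \<mu> (- C) = 0"
    using null_sets_subset null_setsD1 by metis
qed

lemma punctured_integral:
  fixes f :: "complex \<Rightarrow> complex"
  assumes sets: "sets \<mu> = sets borel" and null: "emeasure \<mu> {0} = 0" and [measurable]: "f \<in> borel_measurable borel"
  shows "set_integrable \<mu> (- {0}) f \<longleftrightarrow> integrable \<mu> f" "(LINT z:- {0}|\<mu>. f z) = (LINT z|\<mu>. f z)"
proof -
  note [measurable_cong] = sets
  have "AE z in \<mu>. z \<notin> {0}"
    using null sets by (intro AE_not_in) (auto simp: null_sets_def)
  then have ae: "AE z in \<mu>. indicat_real (- {0}) z *\<^sub>R f z = f z"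
    by (auto elim!: eventually_mono)
  show "set_integrable \<mu> (- {0}) f \<longleftrightarrow> integrable \<mu> f"
    unfolding set_integrable_def using ae by (intro integrable_cong_AE) measurable
  show "(LINT z:- {0}|\<mu>. f z) = (LINT z|\<mu>. f z)"
    unfolding set_lebesgue_integral_def using ae by (intro integral_cong_AE) measurable
qed

lemma mono_zz_integrable_NN_plus:
  assumes "\<mu> \<in> repr_measures \<gamma>" "emeasure \<mu> {0} = 0" "k \<in> NN_plus"
  shows "integrable \<mu> (mono_zz k)"
proof -
  note sets [measurable_cong] = repr_measuresD(1)[OF assms(1)]
  obtain m n where k: "k = (m, n)" "m + n \<ge> 0"
    using assms(3) by (auto simp: NN_plus_def)
  have "AE z in \<mu>. z \<notin> {0}"
    using assms(2) sets by (intro AE_not_in) (auto simp: null_sets_def)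
  then have "AE z in \<mu>. norm (mono_zz k z) \<le> norm (mono_zz (m + n, 0) z)"
    by (auto elim!: eventually_mono simp: k mono_zz_def norm_mult norm_power_int power_int_add)
  moreover have "integrable \<mu> (mono_zz (m + n, 0))"
    using k(2) by (intro repr_measuresD(3)[OF assms(1)]) (simp add: NN_def)
  moreover have "mono_zz k \<in> borel_measurable \<mu>"
    by measurable
  ultimately show ?thesis
    by (rule Bochner_Integration.integrable_bound[rotated 2])
qed

lemma circle_measure_eqI:
  assumes \<sigma>: "circle_measure \<sigma>" and \<rho>: "circle_measure \<rho>"
    and moments: "\<And>k. (LINT u|\<sigma>. u powi k) = (LINT u|\<rho>. u powi k)"
  shows "\<sigma> = \<rho>"
proof (rule measure_eqI)
  interpret \<sigma>: finite_measure \<sigma>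
    using \<sigma> by (simp add: circle_measure_def)
  interpret \<rho>: finite_measure \<rho>
    using \<rho> by (simp add: circle_measure_def)
  have sets: "sets \<sigma> = sets borel"
    using \<sigma> by (simp add: circle_measure_def)
  show "sets \<sigma> = sets \<rho>"
    using \<sigma> \<rho> by (simp add: circle_measure_def)
  fix A assume "A \<in> sets \<sigma>"
  then have A: "A \<in> sets borel"
    by (simp add: sets)
  have "(LINT u:A|\<sigma>. 1) = complex_of_real (measure \<rho> A)"
    using moments by (intro circle_moments_determine_measure[OF \<sigma> \<rho> _ _ A]) simp_all
  moreover have "(LINT u:A|\<sigma>. 1) = complex_of_real (measure \<sigma> A)"
    using A by (simp add: set_lebesgue_integral_def scaleR_conv_of_real sets sets_eq_imp_space_eq[OF sets])
  ultimately show "emeasure \<sigma> A = emeasure \<rho> A"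
    by (simp add: \<sigma>.emeasure_eq_measure \<rho>.emeasure_eq_measure)
qed

lemma AE_not_zero:
  fixes \<mu> :: "complex measure"
  assumes "sets \<mu> = sets borel" "emeasure \<mu> {0} = 0"
  shows "AE z in \<mu>. z \<noteq> 0"
proof -
  have "AE z in \<mu>. z \<notin> {0}"
    using assms by (intro AE_not_in) (auto simp: null_sets_def)
  then show ?thesis by simp
qed

lemma psi_pushforward:
  assumes fin: "finite_measure \<mu>" and sets: "sets \<mu> = sets borel" and null: "emeasure \<mu> {0} = 0"
  shows "circle_measure (distr \<mu> borel psi)"
    and "(LINT u|distr \<mu> borel psi. u powi k) = (LINT z|\<mu>. mono_zz (k, - k) z)"
proof -
  note [measurable_cong] = sets
  have meas [measurable]: "psi \<in> borel_measurable \<mu>"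
    by measurable
  note nz = AE_not_zero[OF sets null]
  have "AE z in \<mu>. norm (psi z) = 1"
    using nz by eventually_elim (rule norm_psi)
  then have "AE u in distr \<mu> borel psi. norm u = 1"
    by (subst AE_distr_iff) auto
  moreover have "finite_measure (distr \<mu> borel psi)"
    using fin meas by (rule finite_measure.finite_measure_distr)
  ultimately show "circle_measure (distr \<mu> borel psi)"
    by (simp add: circle_measure_def)
  have "(LINT u|distr \<mu> borel psi. u powi k) = (LINT z|\<mu>. psi z powi k)"
    by (rule integral_distr) measurable
  also have "\<dots> = (LINT z|\<mu>. mono_zz (k, - k) z)"
  proof (rule integral_cong_AE)
    show "AE z in \<mu>. psi z powi k = mono_zz (k, - k) z"
      using nz by eventually_elim (simp add: mono_zz_conj_diff)
  qed measurable
  finally show "(LINT u|distr \<mu> borel psi. u powi k) = (LINT z|\<mu>. mono_zz (k, - k) z)" .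
qed

text \<open>A closed set \<open>X\<close> agrees up to a null set with the preimage of \<open>psi ` (X \<inter> C)\<close>. This image is a
Borel set because \<open>X \<inter> C\<close> is a countable union of compact sets, on which \<open>psi\<close> is continuous.\<close>

lemma pushforward_determines_measure:
  assumes fin: "finite_measure \<mu>\<^sub>1" "finite_measure \<mu>\<^sub>2"
    and sets: "sets \<mu>\<^sub>1 = sets borel" "sets \<mu>\<^sub>2 = sets borel"
    and null: "emeasure \<mu>\<^sub>1 (- C) = 0" "emeasure \<mu>\<^sub>2 (- C) = 0"
    and C: "closed C" "0 \<notin> C" "inj_on psi C"
    and eq: "distr \<mu>\<^sub>1 borel psi = distr \<mu>\<^sub>2 borel psi"
  shows "\<mu>\<^sub>1 = \<mu>\<^sub>2"
proof (rule measure_eqI_generator_eq[where E = "Collect closed" and \<Omega> = UNIV and A = "\<lambda>_. UNIV"])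
  fix X :: "complex set" assume "X \<in> Collect closed"
  then have X: "closed X" by simp
  have cont: "continuous_on C psi"
    unfolding psi_def[abs_def] using C(2) by (intro continuous_intros) auto
  define K where "K n = X \<inter> C \<inter> cball 0 (real n)" for n
  have "compact (psi ` K n)" for n
    using X C(1) by (intro compact_continuous_image continuous_on_subset[OF cont])
      (auto simp: K_def intro!: closed_Int_compact closed_Int)
  then have "(\<Union>n. psi ` K n) \<in> sets borel"
    by (intro sets.countable_UN) (auto intro: borel_closed compact_imp_closed)
  also have "(\<Union>n. psi ` K n) = psi ` (X \<inter> C)"
  proof -
    have "\<exists>n. z \<in> K n" if "z \<in> X \<inter> C" for z
      using that real_arch_simple[of "norm z"] by (auto simp: K_def)
    then have "(\<Union>n. K n) = X \<inter> C"
      by (auto simp: K_def)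
    then show ?thesis
      unfolding image_UN[symmetric] by simp
  qed
  finally have B: "psi ` (X \<inter> C) \<in> sets borel" .
  have "emeasure \<mu> X = emeasure (distr \<mu> borel psi) (psi ` (X \<inter> C))"
    if sets: "sets \<mu> = sets borel" and null: "emeasure \<mu> (- C) = 0" for \<mu>
  proof -
    have psi: "psi \<in> borel_measurable \<mu>"
      unfolding measurable_cong_sets[OF sets refl] by (rule psi_measurable)
    have vimage: "psi -` (psi ` (X \<inter> C)) \<in> sets \<mu>"
      using measurable_sets[OF psi_measurable B] by (simp add: sets)
    have "AE z in \<mu>. z \<notin> - C"
      using null C(1) by (intro AE_not_in) (auto simp: null_sets_def sets)
    then have "AE z in \<mu>. z \<in> X \<longleftrightarrow> z \<in> psi -` (psi ` (X \<inter> C))"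
      using C(3) by (auto elim!: eventually_mono dest: inj_onD)
    then have "emeasure \<mu> X = emeasure \<mu> (psi -` (psi ` (X \<inter> C)))"
      using X vimage by (intro emeasure_eq_AE) (simp_all add: sets)
    then show ?thesis
      using B psi by (simp add: emeasure_distr sets_eq_imp_space_eq[OF sets])
  qed
  from this[OF sets(1) null(1)] this[OF sets(2) null(2)] show "emeasure \<mu>\<^sub>1 X = emeasure \<mu>\<^sub>2 X"
    by (simp add: eq)
next
  show "emeasure \<mu>\<^sub>1 UNIV \<noteq> \<infinity>"
    using finite_measure.emeasure_finite[OF fin(1)] by simp
  show "sets \<mu>\<^sub>1 = sigma_sets UNIV (Collect closed)" "sets \<mu>\<^sub>2 = sigma_sets UNIV (Collect closed)"
    unfolding sets by (simp_all add: borel_eq_closed)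
qed (auto simp: Int_stable_def)

lemma Gamma_of_eq:
  assumes "sets \<mu> = sets borel" "emeasure \<mu> {0} = 0" "k \<in> NN_plus"
  shows "Gamma_of \<mu> k = (LINT z|\<mu>. mono_zz k z)"
  using assms by (simp add: Gamma_of_def punctured_integral)

lemma Gamma_of_in_PDE:
  assumes \<mu>: "\<mu> \<in> repr_measures \<gamma>" and null: "emeasure \<mu> {0} = 0"
  shows "Gamma_of \<mu> \<in> PDE \<gamma>"
proof -
  note sets = repr_measuresD(1)[OF \<mu>]
  note eq = Gamma_of_eq[OF sets null]
  have "pos_def_plus (Gamma_of \<mu>)"
  proof (rule pos_def_plusI)
    fix F and c :: "int \<times> int \<Rightarrow> complex"
    assume F: "finite F" "F \<subseteq> NN_plus"
    have "(\<Sum>k\<in>F. \<Sum>l\<in>F. c k * cnj (c l) * Gamma_of \<mu> (star_add k l))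
        = (\<Sum>k\<in>F. \<Sum>l\<in>F. c k * cnj (c l) * (LINT z|\<mu>. mono_zz (star_add k l) z))"
      using F(2) by (intro sum.cong refl arg_cong2[of _ _ _ _ "(*)"] eq star_add_NN_plus) auto
    also have "\<dots> = of_real (LINT z|\<mu>. (norm (\<Sum>k\<in>F. c k * mono_zz k z))\<^sup>2)"
    proof (rule gram_integral(2)[OF _ _ sets])
      show "integrable \<mu> (mono_zz (star_add k l))" if "k \<in> F" "l \<in> F" for k l
        using that F(2) by (intro mono_zz_integrable_NN_plus[OF \<mu> null] star_add_NN_plus) auto
      show "AE z in \<mu>. \<forall>k\<in>F. \<forall>l\<in>F. mono_zz (star_add k l) z = mono_zz k z * cnj (mono_zz l z)"
        using AE_not_zero[OF sets null] by eventually_elim (simp add: mono_zz_star_add)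
    qed
    finally show "(\<Sum>k\<in>F. \<Sum>l\<in>F. c k * cnj (c l) * Gamma_of \<mu> (star_add k l)) \<in> \<real>\<^sub>\<ge>\<^sub>0"
      by simp
  qed
  moreover have "Gamma_of \<mu> k = \<gamma> k" if "k \<in> NN" for k
    using that NN_subset_NN_plus by (subst eq) (auto simp: repr_measuresD(4)[OF \<mu>])
  ultimately show ?thesis
    by (auto simp: PDE_def Gamma_of_def)
qed

lemma representing_pair_null_iff:
  "representing_pair \<Gamma> \<mu> (null_measure borel_circle) \<longleftrightarrow>
    sets \<mu> = sets borel \<and> emeasure \<mu> {0} = 0 \<and>
    (\<forall>k\<in>NN_plus. integrable \<mu> (mono_zz k) \<and> \<Gamma> k = (LINT z|\<mu>. mono_zz k z))"
proof -
  have ae: "AE z in null_measure borel_circle. P z" for P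
    by (rule AE_I[of _ _ circle]) (auto simp: space_restrict_space sets_restrict_space)
  have meas: "mono_zz k \<in> borel_measurable (null_measure borel_circle)" for k
    using measurable_restrict_space1[OF mono_zz_measurable[of k], of circle]
    by (simp add: measurable_def)
  have 1: "integrable (null_measure borel_circle) (mono_zz k)" for k
    by (rule integrable_cong_AE_imp[OF integrable_zero meas ae])
  have 2: "(LINT z|null_measure borel_circle. mono_zz k z) = 0" for k
    by (rule integral_eq_zero_AE[OF ae])
  show ?thesis
    unfolding representing_pair_def using 1 2
    by (auto simp: punctured_integral cong: conj_cong)
qed

lemma representing_pair_Gamma_of:
  assumes \<Gamma>: "\<Gamma> \<in> PDE \<gamma>" and pair: "representing_pair \<Gamma> \<mu> (null_measure borel_circle)"
  shows "Gamma_of \<mu> = \<Gamma>"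
proof
  fix k
  show "Gamma_of \<mu> k = \<Gamma> k"
  proof (cases "k \<in> NN_plus")
    case True
    then show ?thesis
      using pair by (simp add: representing_pair_null_iff Gamma_of_eq)
  next
    case False
    then show ?thesis
      using \<Gamma> by (cases k) (auto simp: Gamma_of_def PDE_def PiE_def extensional_def)
  qed
qed

text \<open>As the measure is carried by \<open>Z\<close>, restricting it to \<open>Z\<close> makes no difference.\<close>

lemma psi_image_eq:
  assumes sets: "sets \<mu> = sets borel" and Z: "closed Z" "0 \<notin> Z" and null: "emeasure \<mu> (- Z) = 0"
  shows "psi_image Z \<mu> = restrict_space (distr \<mu> borel psi) circle"
proof (rule measure_eqI)
  have sp: "space \<mu> = UNIV"
    using sets_eq_imp_space_eq[OF sets] by simp
  show sets_eq: "sets (psi_image Z \<mu>) = sets (restrict_space (distr \<mu> borel psi) circle)"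
    by (simp add: psi_image_def cong: sets_restrict_space_cong)
  fix A assume "A \<in> sets (psi_image Z \<mu>)"
  then have A: "A \<in> sets borel_circle"
    by (simp add: psi_image_def)
  then have A_borel: "A \<in> sets borel" and A_sub: "A \<subseteq> circle"
    by (auto simp: sets_restrict_space)
  have psi: "psi \<in> borel_measurable \<mu>"
    unfolding measurable_cong_sets[OF sets refl] by (rule psi_measurable)
  have psi_circle: "psi \<in> measurable (restrict_space \<mu> Z) borel_circle"
    using Z(2) by (intro measurable_restrict_space2 measurable_restrict_space1[OF psi])
      (auto simp: space_restrict_space intro!: norm_psi)
  have vimage: "psi -` A \<in> sets borel"
    using measurable_sets[OF psi_measurable A_borel] by simp
  have "emeasure (psi_image Z \<mu>) A = emeasure (restrict_space \<mu> Z) (psi -` A \<inter> Z)"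
    using psi_circle A by (simp add: psi_image_def emeasure_distr space_restrict_space sp)
  also have "\<dots> = emeasure \<mu> (psi -` A \<inter> Z)"
    using Z(1) by (intro emeasure_restrict_space) (auto simp: sets sp)
  also have "\<dots> = emeasure \<mu> (psi -` A)"
  proof (rule emeasure_eq_AE)
    have "AE z in \<mu>. z \<notin> - Z"
      using null Z(1) by (intro AE_not_in) (auto simp: null_sets_def sets)
    then show "AE z in \<mu>. z \<in> psi -` A \<inter> Z \<longleftrightarrow> z \<in> psi -` A"
      by eventually_elim auto
  qed (use vimage Z(1) in \<open>auto simp: sets\<close>)
  also have "\<dots> = emeasure (distr \<mu> borel psi) A"
    using psi A_borel by (simp add: emeasure_distr sp)
  also have "\<dots> = emeasure (restrict_space (distr \<mu> borel psi) circle) A"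
    using A_sub by (intro emeasure_restrict_space[symmetric]) auto
  finally show "emeasure (psi_image Z \<mu>) A = emeasure (restrict_space (distr \<mu> borel psi) circle) A" .
qed

section \<open>Moment sequences carried by a curve that avoids the origin\<close>

text \<open>The coefficients \<open>\<alpha>\<close> on the finite set \<open>S\<close> of exponents describe a polynomial in \<open>z\<close> and
\<open>cnj z\<close> that does not vanish at the origin.\<close>

locale curve =
  fixes S :: "(int \<times> int) set" and \<alpha> :: "int \<times> int \<Rightarrow> complex"
  assumes finite_S: "finite S" and S_NN: "S \<subseteq> NN"
    and nonzero_at_0: "(\<Sum>k\<in>S. \<alpha> k * mono_zz k 0) \<noteq> 0"
begin

definition q :: "complex \<Rightarrow> complex" where
  "q z = (\<Sum>k\<in>S. \<alpha> k * mono_zz k z)"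

definition Z :: "complex set" where
  "Z = {z. q z = 0}"

lemma zero_notin_Z: "0 \<notin> Z"
  using nonzero_at_0 by (simp add: Z_def q_def)

lemma closed_Z: "closed Z"
proof -
  have "continuous_on UNIV (mono_zz k)" if "k \<in> S" for k
    using that S_NN unfolding mono_zz_def split_beta
    by (intro continuous_intros) (auto simp: NN_def split_beta)
  then have "continuous_on UNIV q"
    unfolding q_def by (intro continuous_intros)
  then show ?thesis
    unfolding Z_def by (intro closed_Collect_eq) auto
qed

text \<open>The sum is the integral of \<open>\<bar>q\<bar>\<^sup>2\<close> against any representing measure, expressed in terms of the
sequence alone.\<close>

definition relation_holds :: "(int \<times> int \<Rightarrow> complex) \<Rightarrow> bool" where
  "relation_holds \<gamma> \<longleftrightarrow> (\<Sum>k\<in>S. \<Sum>l\<in>S. \<alpha> k * cnj (\<alpha> l) * \<gamma> (star_add k l)) = 0"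

lemma relation_holds_iff:
  assumes \<mu>: "\<mu> \<in> repr_measures \<gamma>"
  shows "relation_holds \<gamma> \<longleftrightarrow> emeasure \<mu> (- Z) = 0"
proof -
  note sets [measurable_cong] = repr_measuresD(1)[OF \<mu>]
  have int: "integrable \<mu> (mono_zz (star_add k l))" if "k \<in> S" "l \<in> S" for k l
    using that S_NN by (intro repr_measuresD(3)[OF \<mu>] star_add_NN) auto
  have star: "AE z in \<mu>. \<forall>k\<in>S. \<forall>l\<in>S. mono_zz (star_add k l) z = mono_zz k z * cnj (mono_zz l z)"
    using S_NN by (intro AE_I2 ballI mono_zz_star_add) auto
  have [measurable]: "q \<in> borel_measurable borel"
    unfolding q_def by measurable
  have "(\<Sum>k\<in>S. \<Sum>l\<in>S. \<alpha> k * cnj (\<alpha> l) * \<gamma> (star_add k l))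
      = (\<Sum>k\<in>S. \<Sum>l\<in>S. \<alpha> k * cnj (\<alpha> l) * (LINT z|\<mu>. mono_zz (star_add k l) z))"
    using S_NN by (intro sum.cong refl arg_cong2[of _ _ _ _ "(*)"] repr_measuresD(4)[OF \<mu>] star_add_NN) auto
  also have "\<dots> = of_real (LINT z|\<mu>. (norm (q z))\<^sup>2)"
    unfolding q_def by (rule gram_integral(2)[OF int star sets])
  finally have "relation_holds \<gamma> \<longleftrightarrow> (LINT z|\<mu>. (norm (q z))\<^sup>2) = 0"
    by (simp add: relation_holds_def)
  also have "\<dots> \<longleftrightarrow> (AE z in \<mu>. (norm (q z))\<^sup>2 = 0)"
    unfolding q_def by (intro integral_nonneg_eq_0_iff_AE gram_integral(1)[OF int star sets]) auto
  also have "\<dots> \<longleftrightarrow> (AE z in \<mu>. z \<in> Z)"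
    by (simp add: Z_def)
  also have "\<dots> \<longleftrightarrow> emeasure \<mu> (- Z) = 0"
    using closed_Z by (intro AE_iff_measurable) (auto simp: sets sets_eq_imp_space_eq[OF sets])
  finally show ?thesis .
qed

lemma repr_measure_null_0:
  assumes "\<mu> \<in> repr_measures \<gamma>" "relation_holds \<gamma>"
  shows "emeasure \<mu> {0} = 0"
proof -
  have "emeasure \<mu> {0} \<le> emeasure \<mu> (- Z)"
    using zero_notin_Z closed_Z repr_measuresD(1)[OF assms(1)] by (intro emeasure_mono) auto
  then show ?thesis
    using relation_holds_iff[OF assms(1)] assms(2) by simp
qed

text \<open>In terms of the pair, the sum in \<open>relation_holds \<gamma>\<close> equals the integral of \<open>\<bar>q\<bar>\<^sup>2\<close> against
\<open>\<mu>\<close> plus \<open>\<bar>q 0\<bar>\<^sup>2\<close> times the mass of \<open>\<nu>\<close>, because \<open>\<nu>\<close> contributes exactly to the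
constant terms. Both summands are nonnegative, so both vanish.\<close>

lemma representing_pair_relation:
  assumes \<Gamma>: "\<Gamma> \<in> PDE \<gamma>" and rel: "relation_holds \<gamma>" and pair: "representing_pair \<Gamma> \<mu> \<nu>"
  shows "\<mu> \<in> repr_measures \<gamma>" "\<nu> = null_measure borel_circle"
proof -
  have sets: "sets \<mu> = sets borel" and null: "emeasure \<mu> {0} = 0" and sets_\<nu>: "sets \<nu> = sets borel_circle"
    using pair by (auto simp: representing_pair_def)
  have int: "integrable \<mu> (mono_zz k)" and int_\<nu>: "integrable \<nu> (mono_zz k)"
    and \<Gamma>_eq: "\<Gamma> k = (LINT z|\<mu>. mono_zz k z) + of_bool (fst k + snd k = 0) * (LINT z|\<nu>. mono_zz k z)"
    if "k \<in> NN_plus" for k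
    using pair that by (auto simp: representing_pair_def punctured_integral[OF sets null])
  have "integrable \<nu> (\<lambda>_. 1 :: complex)"
    using int_\<nu>[of "(0, 0)"] by (simp add: NN_plus_def mono_zz_def)
  then have fin: "finite_measure \<nu>"
    by (intro finite_measureI) (simp add: integrable_iff_bounded)
  have \<nu>_eq: "of_bool (fst (star_add k l) + snd (star_add k l) = 0) * (LINT z|\<nu>. mono_zz (star_add k l) z)
      = mono_zz k 0 * cnj (mono_zz l 0) * measure \<nu> (space \<nu>)" if "k \<in> NN" "l \<in> NN" for k l
  proof (cases "fst (star_add k l) + snd (star_add k l) = 0")
    case True
    with that have "k = (0, 0)" "l = (0, 0)"
      by (auto simp: star_add_def NN_def)
    then show ?thesis
      by (simp add: star_add_def mono_zz_def scaleR_conv_of_real)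
  next
    case False
    then have "mono_zz (star_add k l) 0 = 0"
      using that by (simp add: mono_zz_0 star_add_NN)
    then have "mono_zz k 0 * cnj (mono_zz l 0) = 0"
      using that by (subst (asm) mono_zz_star_add) auto
    with False show ?thesis by simp
  qed
  have "0 = (\<Sum>k\<in>S. \<Sum>l\<in>S. \<alpha> k * cnj (\<alpha> l) * \<Gamma> (star_add k l))"
  proof -
    have "(\<Sum>k\<in>S. \<Sum>l\<in>S. \<alpha> k * cnj (\<alpha> l) * \<Gamma> (star_add k l))
        = (\<Sum>k\<in>S. \<Sum>l\<in>S. \<alpha> k * cnj (\<alpha> l) * \<gamma> (star_add k l))"
      using \<Gamma> S_NN star_add_NN by (intro sum.cong refl) (auto simp: PDE_def subset_iff)
    then show ?thesis
      using rel by (simp add: relation_holds_def)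
  qed
  also have "\<dots> = (\<Sum>k\<in>S. \<Sum>l\<in>S. \<alpha> k * cnj (\<alpha> l) * ((LINT z|\<mu>. mono_zz (star_add k l) z)
      + mono_zz k 0 * cnj (mono_zz l 0) * measure \<nu> (space \<nu>)))"
  proof (intro sum.cong refl arg_cong2[of _ _ _ _ "(*)"])
    fix k l assume "k \<in> S" "l \<in> S"
    then have "k \<in> NN" "l \<in> NN"
      using S_NN by auto
    then show "\<Gamma> (star_add k l) = (LINT z|\<mu>. mono_zz (star_add k l) z)
        + mono_zz k 0 * cnj (mono_zz l 0) * measure \<nu> (space \<nu>)"
      using NN_subset_NN_plus by (subst \<Gamma>_eq) (auto simp only: \<nu>_eq intro: star_add_NN)
  qed
  also have "\<dots> = (\<Sum>k\<in>S. \<Sum>l\<in>S. \<alpha> k * cnj (\<alpha> l) * (LINT z|\<mu>. mono_zz (star_add k l) z))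
      + (\<Sum>k\<in>S. \<Sum>l\<in>S. (\<alpha> k * mono_zz k 0) * cnj (\<alpha> l * mono_zz l 0) * measure \<nu> (space \<nu>))"
    by (simp add: distrib_left sum.distrib mult_ac)
  also have "(\<Sum>k\<in>S. \<Sum>l\<in>S. \<alpha> k * cnj (\<alpha> l) * (LINT z|\<mu>. mono_zz (star_add k l) z))
      = of_real (LINT z|\<mu>. (norm (q z))\<^sup>2)"
    unfolding q_def
  proof (rule gram_integral(2)[OF _ _ sets])
    show "integrable \<mu> (mono_zz (star_add k l))" if "k \<in> S" "l \<in> S" for k l
      using that S_NN NN_subset_NN_plus by (intro int star_add_NN_plus) auto
    show "AE z in \<mu>. \<forall>k\<in>S. \<forall>l\<in>S. mono_zz (star_add k l) z = mono_zz k z * cnj (mono_zz l z)"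
      using AE_not_zero[OF sets null] by eventually_elim (simp add: mono_zz_star_add)
  qed
  also have "(\<Sum>k\<in>S. \<Sum>l\<in>S. (\<alpha> k * mono_zz k 0) * cnj (\<alpha> l * mono_zz l 0) * measure \<nu> (space \<nu>))
      = q 0 * cnj (q 0) * measure \<nu> (space \<nu>)"
    by (simp only: q_def cnj_sum sum_product) (simp only: sum_distrib_right)
  also have "\<dots> = of_real ((norm (q 0))\<^sup>2 * measure \<nu> (space \<nu>))"
    by (simp only: complex_norm_square of_real_mult)
  finally have "complex_of_real ((LINT z|\<mu>. (norm (q z))\<^sup>2) + (norm (q 0))\<^sup>2 * measure \<nu> (space \<nu>)) = 0"
    by simp
  then have "(LINT z|\<mu>. (norm (q z))\<^sup>2) + (norm (q 0))\<^sup>2 * measure \<nu> (space \<nu>) = 0"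
    by (simp only: of_real_eq_0_iff)
  moreover have "(LINT z|\<mu>. (norm (q z))\<^sup>2) \<ge> 0"
    by simp
  ultimately have "(norm (q 0))\<^sup>2 * measure \<nu> (space \<nu>) \<le> 0"
    by linarith
  moreover have "(norm (q 0))\<^sup>2 > 0"
    using zero_notin_Z by (simp add: Z_def)
  ultimately have "measure \<nu> (space \<nu>) \<le> 0"
    by (simp add: mult_le_0_iff)
  then have "measure \<nu> (space \<nu>) = 0"
    using measure_nonneg[of \<nu> "space \<nu>"] by linarith
  then have \<nu>0: "emeasure \<nu> (space \<nu>) = 0"
    using fin by (simp add: finite_measure.emeasure_eq_measure)
  show \<nu>: "\<nu> = null_measure borel_circle"
  proof (rule measure_eqI)
    fix A assume "A \<in> sets \<nu>"
    then show "emeasure \<nu> A = emeasure (null_measure borel_circle) A"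
      using \<nu>0 emeasure_space[of \<nu> A] by simp
  qed (simp add: sets_\<nu>)
  have "representing_pair \<Gamma> \<mu> (null_measure borel_circle)"
    using pair by (simp add: \<nu>)
  then have \<Gamma>_\<mu>: "\<Gamma> k = (LINT z|\<mu>. mono_zz k z)" if "k \<in> NN_plus" for k
    using that by (simp add: representing_pair_null_iff)
  have "integrable \<mu> (mono_zz k) \<and> \<gamma> k = (LINT z|\<mu>. mono_zz k z)" if "k \<in> NN" for k
  proof -
    have "k \<in> NN_plus" "\<gamma> k = \<Gamma> k"
      using that NN_subset_NN_plus \<Gamma> by (auto simp: PDE_def)
    then show ?thesis
      using int \<Gamma>_\<mu> by simp
  qed
  then show "\<mu> \<in> repr_measures \<gamma>"
    using sets by (simp add: repr_measures_def)
qed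

text \<open>The points \<open>z\<close> with \<open>psi z = u\<close> are the nonzero real multiples of the square root \<open>v\<close> of \<open>u\<close>. In the
coordinate \<open>r\<close> with \<open>z = v * r\<close> the functional with moments \<open>g j\<close> of \<open>cnj z ^ j\<close> becomes a functional
with moments \<open>s j = v ^ j * g j\<close> of \<open>r ^ j\<close>, which is positive semidefinite and annihilates the
polynomial \<open>P\<close> whose values at real \<open>r\<close> are \<open>q (v * r)\<close>. Different real roots of \<open>P\<close> would be points of
\<open>Z\<close> with the same image under \<open>psi\<close>.\<close>

lemma fiber_of_relation:
  fixes g :: "nat \<Rightarrow> complex"
  assumes u: "norm u = 1"
    and psd: "\<And>N f. (\<Sum>j\<le>N. \<Sum>l\<le>N. f j * cnj (f l) * (u powi int l * g (j + l))) \<in> \<real>\<^sub>\<ge>\<^sub>0"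
    and ann: "\<And>j. (\<Sum>k\<in>S. \<alpha> k * (u powi fst k * g (nat (fst k + snd k) + j))) = 0"
    and inj: "inj_on psi Z"
  shows "g 0 \<in> \<real>\<^sub>\<ge>\<^sub>0" and "(\<forall>j. g j = 0) \<or> (\<exists>z\<in>Z. psi z = u \<and> (\<forall>j. g j = g 0 * cnj z ^ j))"
proof -
  show "g 0 \<in> \<real>\<^sub>\<ge>\<^sub>0"
    using psd[where N = 0 and f = "\<lambda>_. 1"] by simp
  define v where "v = csqrt u"
  have v2: "v\<^sup>2 = u"
    by (simp add: v_def)
  then have "(norm v)\<^sup>2 = 1"
    using u by (simp flip: norm_power)
  then have norm_v: "norm v = 1"
    by (simp add: power2_eq_1_iff) (use norm_ge_zero[of v] in linarith)
  then have v0: "v \<noteq> 0" by auto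
  have cnj_v: "cnj v = inverse v"
    using norm_v by (simp add: inverse_eq_divide divide_conv_cnj)
  define s where "s j = v ^ j * g j" for j
  define P where "P = (\<Sum>k\<in>S. monom (\<alpha> k * mono_zz k v) (nat (fst k + snd k)))"
  have poly_P: "poly P (of_real r) = q (v * of_real r)" for r :: real
  proof -
    have "mono_zz k v * of_real r ^ nat (fst k + snd k) = mono_zz k (v * of_real r)" if "k \<in> S" for k
    proof -
      from that S_NN obtain m n :: nat where k: "k = (int m, int n)"
        by (cases k) (auto simp: NN_def elim!: nonneg_int_cases)
      then have "nat (fst k + snd k) = m + n" by auto
      then show ?thesis
        by (simp add: k mono_zz_def power_mult_distrib power_add mult_ac)
    qed
    then show ?thesis
      by (simp add: P_def q_def poly_sum poly_monom mult.assoc)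
  qed
  have "(\<forall>j. s j = 0) \<or> (\<exists>r :: real. poly P (of_real r) = 0 \<and> (\<forall>j. s j = s 0 * of_real r ^ j))"
  proof (rule psd_functional_point_evaluation)
    show "P \<noteq> 0"
      using poly_P[of 0] zero_notin_Z by (auto simp: Z_def)
    show "poly_functional s (f * map_poly cnj f) \<in> \<real>\<^sub>\<ge>\<^sub>0" for f
    proof -
      let ?n = "degree f"
      have "poly_functional s (f * map_poly cnj f)
          = (\<Sum>j\<le>?n. \<Sum>l\<le>?n. coeff f j * coeff (map_poly cnj f) l * s (j + l))"
        by (intro poly_functional_mult) (simp_all add: degree_map_poly)
      also have "\<dots> = (\<Sum>j\<le>?n. \<Sum>l\<le>?n. (coeff f j * v ^ j) * cnj (coeff f l * v ^ l) * (u powi int l * g (j + l)))"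
      proof (intro sum.cong refl)
        fix j l
        have "cnj (v ^ l) * u powi int l = v ^ l"
          using v0 by (simp add: cnj_v flip: v2) (simp add: power2_eq_square power_mult_distrib field_simps)
        then have "v ^ j * (cnj (v ^ l) * u powi int l) * g (j + l) = s (j + l)"
          by (simp add: s_def power_add)
        then show "coeff f j * coeff (map_poly cnj f) l * s (j + l)
            = (coeff f j * v ^ j) * cnj (coeff f l * v ^ l) * (u powi int l * g (j + l))"
          by (simp add: coeff_map_poly mult_ac)
      qed
      finally show ?thesis
        by (simp only: psd)
    qed
    show "poly_functional s (P * f) = 0" for f
    proof -
      have summand: "poly_functional s (monom (\<alpha> k * mono_zz k v) (nat (fst k + snd k)) * f)
          = (\<Sum>l\<le>degree f. coeff f l * v ^ l * (\<alpha> k * (u powi fst k * g (nat (fst k + snd k) + l))))"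
        if "k \<in> S" for k
      proof -
        from that S_NN obtain m n :: nat where k: "k = (int m, int n)"
          by (cases k) (auto simp: NN_def elim!: nonneg_int_cases)
        then have mn: "nat (fst k + snd k) = m + n" by auto
        have "monom (\<alpha> k * mono_zz k v) (m + n) * f
            = (\<Sum>l\<le>degree f. monom (\<alpha> k * mono_zz k v * coeff f l) (m + n + l))"
          by (subst poly_as_sum_of_monoms[of f, symmetric]) (simp add: sum_distrib_left mult_monom)
        then have "poly_functional s (monom (\<alpha> k * mono_zz k v) (m + n) * f)
            = (\<Sum>l\<le>degree f. \<alpha> k * mono_zz k v * coeff f l * s (m + n + l))"
          by (simp add: poly_functional_sum poly_functional_monom)
        also have "\<dots> = (\<Sum>l\<le>degree f. coeff f l * v ^ l * (\<alpha> k * (u powi fst k * g (m + n + l))))"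
        proof (intro sum.cong refl)
          fix l
          have "mono_zz k v * v ^ (m + n) = u powi fst k"
            using v0 by (simp add: k mono_zz_def cnj_v power_add flip: v2)
              (simp add: power2_eq_square power_mult_distrib field_simps)
          then have "mono_zz k v * s (m + n + l) = v ^ l * (u powi fst k * g (m + n + l))"
            by (simp add: s_def power_add mult_ac flip: \<open>mono_zz k v * v ^ (m + n) = u powi fst k\<close>)
          then show "\<alpha> k * mono_zz k v * coeff f l * s (m + n + l)
              = coeff f l * v ^ l * (\<alpha> k * (u powi fst k * g (m + n + l)))"
            by (simp add: mult_ac)
        qed
        finally show ?thesis
          by (simp add: mn)
      qed
      have "poly_functional s (P * f)
          = (\<Sum>k\<in>S. \<Sum>l\<le>degree f. coeff f l * v ^ l * (\<alpha> k * (u powi fst k * g (nat (fst k + snd k) + l))))"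
        by (simp add: P_def sum_distrib_right poly_functional_sum summand)
      also have "\<dots> = (\<Sum>l\<le>degree f. \<Sum>k\<in>S. coeff f l * v ^ l * (\<alpha> k * (u powi fst k * g (nat (fst k + snd k) + l))))"
        by (rule sum.swap)
      also have "\<dots> = 0"
        by (simp only: ann mult_zero_right sum.neutral_const flip: sum_distrib_left)
      finally show ?thesis .
    qed
    show "r = r'" if "poly P (of_real r) = 0" "poly P (of_real r') = 0" for r r' :: real
    proof -
      have Z: "v * of_real r \<in> Z" "v * of_real r' \<in> Z"
        using that by (auto simp: Z_def poly_P)
      then have "r \<noteq> 0" "r' \<noteq> 0"
        using zero_notin_Z by auto
      then have "psi (v * of_real r) = psi (v * of_real r')"
        by (simp add: psi_def)
      then show ?thesis
        using inj_onD[OF inj _ Z] v0 by simp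
    qed
  qed
  then show "(\<forall>j. g j = 0) \<or> (\<exists>z\<in>Z. psi z = u \<and> (\<forall>j. g j = g 0 * cnj z ^ j))"
  proof (elim disjE exE conjE)
    assume "\<forall>j. s j = 0"
    with v0 show ?thesis
      by (simp add: s_def)
  next
    fix r :: real
    assume r: "poly P (of_real r) = 0" "\<forall>j. s j = s 0 * of_real r ^ j"
    define z where "z = v * of_real r"
    have z: "z \<in> Z"
      using r(1) by (simp add: Z_def poly_P z_def)
    with zero_notin_Z have "r \<noteq> 0"
      by (auto simp: z_def)
    then have "psi z = u"
      by (simp add: psi_def z_def cnj_v flip: v2) (simp add: power2_eq_square divide_inverse)
    moreover have "g j = g 0 * cnj z ^ j" for j
      using r(2) v0 by (simp add: s_def z_def cnj_v power_mult_distrib field_simps)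
    ultimately show ?thesis
      using z by blast
  qed
qed

text \<open>The coefficients \<open>\<alpha>\<close> are a null vector of the positive semidefinite form of \<open>\<Gamma>\<close>.\<close>

lemma relation_annihilates:
  assumes \<Gamma>: "\<Gamma> \<in> PDE \<gamma>" and rel: "relation_holds \<gamma>" and e: "e \<in> NN_plus"
  shows "(\<Sum>k\<in>S. \<alpha> k * \<Gamma> (star_add k e)) = 0"
proof -
  define a where "a k = (if k \<in> S then \<alpha> k else 0)" for k
  have fin: "finite (insert e S)" and sub: "insert e S \<subseteq> NN_plus"
    using finite_S S_NN NN_subset_NN_plus e by auto
  have "(\<Sum>k\<in>insert e S. a k * \<Gamma> (star_add k e)) = 0"
  proof (rule psd_null_vector[OF fin])
    show "(\<Sum>k\<in>insert e S. \<Sum>l\<in>insert e S. c k * cnj (c l) * \<Gamma> (star_add k l)) \<in> \<real>\<^sub>\<ge>\<^sub>0" for c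
      using \<Gamma> fin sub by (intro pos_def_plus_sum) (auto simp: PDE_def)
    have "(\<Sum>k\<in>insert e S. \<Sum>l\<in>insert e S. a k * cnj (a l) * \<Gamma> (star_add k l))
        = (\<Sum>k\<in>S. \<Sum>l\<in>insert e S. a k * cnj (a l) * \<Gamma> (star_add k l))"
      using fin by (intro sum.mono_neutral_right) (auto simp: a_def)
    also have "\<dots> = (\<Sum>k\<in>S. \<Sum>l\<in>S. a k * cnj (a l) * \<Gamma> (star_add k l))"
      using fin by (intro sum.cong refl sum.mono_neutral_right) (auto simp: a_def)
    also have "\<dots> = (\<Sum>k\<in>S. \<Sum>l\<in>S. \<alpha> k * cnj (\<alpha> l) * \<gamma> (star_add k l))"
      using \<Gamma> S_NN star_add_NN by (intro sum.cong refl) (auto simp: a_def PDE_def subset_iff)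
    finally show "(\<Sum>k\<in>insert e S. \<Sum>l\<in>insert e S. a k * cnj (a l) * \<Gamma> (star_add k l)) = 0"
      using rel by (simp add: relation_holds_def)
  qed simp
  also have "(\<Sum>k\<in>insert e S. a k * \<Gamma> (star_add k e)) = (\<Sum>k\<in>S. a k * \<Gamma> (star_add k e))"
    using fin by (intro sum.mono_neutral_right) (auto simp: a_def)
  finally show ?thesis
    by (simp add: a_def)
qed

text \<open>The Fourier coefficients of the density in question are the values of \<open>\<Gamma>\<close> at multiples of the
relation, which vanish by \<open>relation_annihilates\<close>.\<close>

lemma disintegration_fiber_annihilated:
  assumes \<Gamma>: "\<Gamma> \<in> PDE \<gamma>" and rel: "relation_holds \<gamma>"
    and \<sigma>: "circle_measure \<sigma>" and g: "\<And>j. integrable \<sigma> (g j)"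
    and dis: "\<And>k j. \<Gamma> (k, int j - k) = (LINT u|\<sigma>. u powi k * g j u)"
  shows "AE u in \<sigma>. \<forall>j. (\<Sum>k\<in>S. \<alpha> k * (u powi fst k * g (nat (fst k + snd k) + j) u)) = 0"
  unfolding AE_all_countable
proof
  fix j
  define G where "G u = (\<Sum>k\<in>S. \<alpha> k * (u powi fst k * g (nat (fst k + snd k) + j) u))" for u
  have sets [measurable_cong]: "sets \<sigma> = sets borel" and "finite_measure \<sigma>" and circle: "AE u in \<sigma>. norm u = 1"
    using \<sigma> by (auto simp: circle_measure_def)
  then interpret finite_measure \<sigma> by simp
  have [measurable]: "g j \<in> borel_measurable \<sigma>" for j
    using g by auto
  have int: "integrable \<sigma> (\<lambda>u. \<alpha> k * (u powi i * g m u))" for k i m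
    using circle_integrable_powi[OF \<sigma> g] by simp
  have G: "integrable \<sigma> G"
    unfolding G_def by (intro Bochner_Integration.integrable_sum int)
  have "(LINT u|\<sigma>. u powi i * G u) = 0" for i
  proof -
    have "(LINT u|\<sigma>. u powi i * G u)
        = (LINT u|\<sigma>. (\<Sum>k\<in>S. \<alpha> k * (u powi (fst k + i) * g (nat (fst k + snd k) + j) u)))"
    proof (rule integral_cong_AE)
      show "AE u in \<sigma>. u powi i * G u = (\<Sum>k\<in>S. \<alpha> k * (u powi (fst k + i) * g (nat (fst k + snd k) + j) u))"
        using circle
      proof eventually_elim
        case (elim u)
        then have "u \<noteq> 0" by auto
        then show ?case
          by (simp add: G_def sum_distrib_left power_int_add mult_ac)
      qed
    qed (unfold G_def, measurable)
    also have "\<dots> = (\<Sum>k\<in>S. \<alpha> k * (LINT u|\<sigma>. u powi (fst k + i) * g (nat (fst k + snd k) + j) u))"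
      by (simp only: Bochner_Integration.integral_sum int integral_mult_right_zero)
    also have "\<dots> = (\<Sum>k\<in>S. \<alpha> k * \<Gamma> (star_add k (int j - i, i)))"
    proof (intro sum.cong refl arg_cong2[of _ _ _ _ "(*)"])
      fix k assume "k \<in> S"
      with S_NN have "fst k + snd k \<ge> 0"
        by (auto simp: NN_def)
      then have "int (nat (fst k + snd k) + j) - (fst k + i) = snd k + (int j - i)"
        by simp
      then have "star_add k (int j - i, i) = (fst k + i, int (nat (fst k + snd k) + j) - (fst k + i))"
        by (simp only: star_add_def fst_conv snd_conv)
      then show "(LINT u|\<sigma>. u powi (fst k + i) * g (nat (fst k + snd k) + j) u) = \<Gamma> (star_add k (int j - i, i))"
        by (simp only: dis)
    qed
    also have "\<dots> = 0"
      by (rule relation_annihilates[OF \<Gamma> rel]) (simp add: NN_plus_def)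
    finally show ?thesis .
  qed
  moreover have null: "circle_measure (null_measure borel)"
    by (auto simp: circle_measure_def intro!: finite_measureI AE_I[of _ _ UNIV])
  moreover have "(LINT u|null_measure borel. u powi i) = (0 :: complex)" for i
    by (intro integral_eq_zero_AE AE_I[of _ _ UNIV]) auto
  ultimately have "(LINT u:A|\<sigma>. G u) = of_real (measure (null_measure borel) A)" if "A \<in> sets borel" for A
    using that by (intro circle_moments_determine_measure[OF \<sigma> null G]) simp_all
  then have "AE u in \<sigma>. G u = 0"
    by (intro density_zero[OF G]) (simp add: sets)
  then show "AE u in \<sigma>. (\<Sum>k\<in>S. \<alpha> k * (u powi fst k * g (nat (fst k + snd k) + j) u)) = 0"
    by (simp add: G_def)
qed

text \<open>In almost every fiber the functional is \<open>g 0 u\<close> times the evaluation at a point \<open>z\<close> of \<open>Z\<close>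
with \<open>psi z = u\<close>. This point is \<open>\<zeta> u = cnj (g 1 u / g 0 u)\<close>, which is visibly measurable in
\<open>u\<close>; points \<open>u\<close> with \<open>g 0 u = 0\<close>, where the quotient is \<open>0\<close> by convention, carry no mass.
The image under \<open>\<zeta>\<close> of the measure with density \<open>g 0\<close> represents \<open>\<Gamma>\<close>.\<close>

proposition PDE_represented:
  assumes \<Gamma>: "\<Gamma> \<in> PDE \<gamma>" and rel: "relation_holds \<gamma>" and inj: "inj_on psi Z"
  shows "\<exists>\<mu>. representing_pair \<Gamma> \<mu> (null_measure borel_circle)"
proof -
  have pd: "pos_def_plus \<Gamma>"
    using \<Gamma> by (simp add: PDE_def)
  obtain \<sigma> g where \<sigma>: "circle_measure \<sigma>" and g: "\<And>j :: nat. integrable \<sigma> (g j)"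
    and dis: "\<And>k j. \<Gamma> (k, int j - k) = (LINT u|\<sigma>. u powi k * g j u)"
    using pos_def_disintegration[OF pd] by blast
  have sets [measurable_cong]: "sets \<sigma> = sets borel" and circle: "AE u in \<sigma>. norm u = 1"
    using \<sigma> by (auto simp: circle_measure_def)
  have [measurable]: "g j \<in> borel_measurable \<sigma>" for j
    using g by auto
  have fiber: "AE u in \<sigma>. norm u = 1 \<and> g 0 u \<in> \<real>\<^sub>\<ge>\<^sub>0 \<and>
      ((\<forall>j. g j u = 0) \<or> (\<exists>z\<in>Z. psi z = u \<and> (\<forall>j. g j u = g 0 u * cnj z ^ j)))"
    using circle disintegration_fiber_psd[OF pd \<sigma> g dis] disintegration_fiber_annihilated[OF \<Gamma> rel \<sigma> g dis]
  proof eventually_elim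
    case (elim u)
    then show ?case
      using fiber_of_relation[OF elim(1) _ _ inj, of "\<lambda>j. g j u"] by blast
  qed
  define w where "w u = Re (g 0 u)" for u
  define \<zeta> where "\<zeta> u = cnj (g 1 u / g 0 u)" for u
  have w [measurable]: "w \<in> borel_measurable \<sigma>"
    unfolding w_def by measurable
  have [measurable]: "cnj \<in> borel_measurable borel"
    by (intro borel_measurable_continuous_onI continuous_intros)
  have \<zeta> [measurable]: "\<zeta> \<in> borel_measurable \<sigma>"
    unfolding \<zeta>_def by measurable
  have w_nonneg: "AE u in \<sigma>. 0 \<le> w u"
    using fiber by eventually_elim (auto simp: w_def complex_nonneg_Reals_iff)
  have \<zeta>_nonzero: "AE u in \<sigma>. w u > 0 \<longrightarrow> \<zeta> u \<noteq> 0"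
    and transported: "AE u in \<sigma>. \<forall>k\<in>NN_plus. w u *\<^sub>R mono_zz k (\<zeta> u) = u powi fst k * g (nat (fst k + snd k)) u"
  proof -
    have "AE u in \<sigma>. (w u > 0 \<longrightarrow> \<zeta> u \<noteq> 0) \<and>
        (\<forall>k\<in>NN_plus. w u *\<^sub>R mono_zz k (\<zeta> u) = u powi fst k * g (nat (fst k + snd k)) u)"
      using fiber
    proof eventually_elim
      case (elim u)
      then have w: "g 0 u = of_real (w u)"
        by (auto simp: w_def complex_nonneg_Reals_iff complex_eq_iff)
      show ?case
      proof (cases "w u = 0")
        case True
        with elim w have "g j u = 0" for j by auto
        with True show ?thesis by simp
      next
        case False
        with elim w obtain z where z: "z \<in> Z" "psi z = u" "\<And>j. g j u = of_real (w u) * cnj z ^ j"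
          by force
        then have "z \<noteq> 0"
          using zero_notin_Z by auto
        have \<zeta>: "\<zeta> u = z"
          using False z(3)[of 1] by (simp add: \<zeta>_def w)
        have "w u *\<^sub>R mono_zz k (\<zeta> u) = u powi fst k * g (nat (fst k + snd k)) u" if k_NN_plus: "k \<in> NN_plus" for k
        proof -
          obtain m n where k: "k = (m, n)" "m + n \<ge> 0"
            using k_NN_plus by (auto simp: NN_plus_def)
          then show ?thesis
            using \<open>z \<noteq> 0\<close> by (simp add: \<zeta> mono_zz_polar z(2,3) power_int_def scaleR_conv_of_real)
        qed
        with \<zeta> \<open>z \<noteq> 0\<close> show ?thesis by blast
      qed
    qed
    then show "AE u in \<sigma>. w u > 0 \<longrightarrow> \<zeta> u \<noteq> 0"
      and "AE u in \<sigma>. \<forall>k\<in>NN_plus. w u *\<^sub>R mono_zz k (\<zeta> u) = u powi fst k * g (nat (fst k + snd k)) u"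
      by (auto elim: eventually_mono)
  qed
  define \<mu> where "\<mu> = distr (density \<sigma> (\<lambda>u. ennreal (w u))) borel \<zeta>"
  have sets_\<mu>: "sets \<mu> = sets borel"
    by (simp add: \<mu>_def)
  have "AE z in \<mu>. z \<noteq> 0"
    unfolding \<mu>_def using \<zeta>_nonzero by (subst AE_distr_iff) (simp_all add: AE_density)
  then have null: "emeasure \<mu> {0} = 0"
    by (subst (asm) AE_iff_measurable[of "{0}"]) (auto simp: \<mu>_def)
  have "integrable \<mu> (mono_zz k) \<and> \<Gamma> k = (LINT z|\<mu>. mono_zz k z)" if k: "k \<in> NN_plus" for k
  proof
    have ae: "AE u in \<sigma>. w u *\<^sub>R mono_zz k (\<zeta> u) = u powi fst k * g (nat (fst k + snd k)) u"
      using transported by eventually_elim (use k in blast)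
    have meas: "(\<lambda>u. w u *\<^sub>R mono_zz k (\<zeta> u)) \<in> borel_measurable \<sigma>"
      "(\<lambda>u. mono_zz k (\<zeta> u)) \<in> borel_measurable \<sigma>"
      "(\<lambda>u. u powi fst k * g (nat (fst k + snd k)) u) \<in> borel_measurable \<sigma>"
      by measurable
    have "integrable \<sigma> (\<lambda>u. w u *\<^sub>R mono_zz k (\<zeta> u)) \<longleftrightarrow>
        integrable \<sigma> (\<lambda>u. u powi fst k * g (nat (fst k + snd k)) u)"
      by (rule integrable_cong_AE[OF meas(1,3) ae])
    then have "integrable \<sigma> (\<lambda>u. w u *\<^sub>R mono_zz k (\<zeta> u))"
      using circle_integrable_powi[OF \<sigma> g] by blast
    then have "integrable (density \<sigma> (\<lambda>u. ennreal (w u))) (\<lambda>u. mono_zz k (\<zeta> u))"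
      by (subst integrable_density[OF meas(2) w w_nonneg])
    then show "integrable \<mu> (mono_zz k)"
      unfolding \<mu>_def by (subst integrable_distr_eq) auto
    have "(LINT z|\<mu>. mono_zz k z) = (LINT u|density \<sigma> (\<lambda>u. ennreal (w u)). mono_zz k (\<zeta> u))"
      unfolding \<mu>_def by (rule integral_distr) auto
    also have "\<dots> = (LINT u|\<sigma>. w u *\<^sub>R mono_zz k (\<zeta> u))"
      by (rule integral_density[OF meas(2) w w_nonneg])
    also have "\<dots> = (LINT u|\<sigma>. u powi fst k * g (nat (fst k + snd k)) u)"
      by (rule integral_cong_AE[OF meas(1,3) ae])
    also have "\<dots> = \<Gamma> (fst k, int (nat (fst k + snd k)) - fst k)"
      by (rule dis[symmetric])
    also have "(fst k, int (nat (fst k + snd k)) - fst k) = k"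
      using k by (auto simp: NN_plus_def)
    finally show "\<Gamma> k = (LINT z|\<mu>. mono_zz k z)" ..
  qed
  then show ?thesis
    using sets_\<mu> null by (auto simp: representing_pair_null_iff)
qed

lemma repr_measure_representing_pair:
  assumes \<mu>: "\<mu> \<in> repr_measures \<gamma>" and rel: "relation_holds \<gamma>"
  shows "representing_pair (Gamma_of \<mu>) \<mu> (null_measure borel_circle)"
proof -
  note null = repr_measure_null_0[OF \<mu> rel] and sets = repr_measuresD(1)[OF \<mu>]
  show ?thesis
    using mono_zz_integrable_NN_plus[OF \<mu> null] Gamma_of_eq[OF sets null]
    by (simp add: representing_pair_null_iff sets null)
qed

lemma Gamma_of_determines_pushforward:
  assumes rel: "relation_holds \<gamma>" and \<mu>: "\<mu>\<^sub>1 \<in> repr_measures \<gamma>" "\<mu>\<^sub>2 \<in> repr_measures \<gamma>"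
    and eq: "Gamma_of \<mu>\<^sub>1 = Gamma_of \<mu>\<^sub>2"
  shows "distr \<mu>\<^sub>1 borel psi = distr \<mu>\<^sub>2 borel psi"
proof (rule circle_measure_eqI)
  note D1 = repr_measuresD(2,1)[OF \<mu>(1)] repr_measure_null_0[OF \<mu>(1) rel]
    and D2 = repr_measuresD(2,1)[OF \<mu>(2)] repr_measure_null_0[OF \<mu>(2) rel]
  show "circle_measure (distr \<mu>\<^sub>1 borel psi)" "circle_measure (distr \<mu>\<^sub>2 borel psi)"
    by (rule psi_pushforward(1)[OF D1] psi_pushforward(1)[OF D2])+
  show "(LINT u|distr \<mu>\<^sub>1 borel psi. u powi k) = (LINT u|distr \<mu>\<^sub>2 borel psi. u powi k)" for k
  proof -
    have k: "(k, - k) \<in> NN_plus"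
      by (simp add: NN_plus_def)
    show ?thesis
      unfolding psi_pushforward(2)[OF D1] psi_pushforward(2)[OF D2]
      using Gamma_of_eq[OF D1(2,3) k] Gamma_of_eq[OF D2(2,3) k] eq by simp
  qed
qed

lemma Gamma_of_inj_on:
  assumes rel: "relation_holds \<gamma>" and C: "closed C" "C \<subseteq> Z" "inj_on psi C"
  shows "inj_on Gamma_of {\<mu> \<in> repr_measures \<gamma>. msupp \<mu> \<subseteq> C}"
proof (rule inj_onI)
  fix \<mu>\<^sub>1 \<mu>\<^sub>2
  assume \<mu>: "\<mu>\<^sub>1 \<in> {\<mu> \<in> repr_measures \<gamma>. msupp \<mu> \<subseteq> C}" "\<mu>\<^sub>2 \<in> {\<mu> \<in> repr_measures \<gamma>. msupp \<mu> \<subseteq> C}"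
    and "Gamma_of \<mu>\<^sub>1 = Gamma_of \<mu>\<^sub>2"
  then have repr: "\<mu>\<^sub>1 \<in> repr_measures \<gamma>" "\<mu>\<^sub>2 \<in> repr_measures \<gamma>"
    and push: "distr \<mu>\<^sub>1 borel psi = distr \<mu>\<^sub>2 borel psi"
    using Gamma_of_determines_pushforward[OF rel] by auto
  note sets = repr_measuresD(1)[OF repr(1)] repr_measuresD(1)[OF repr(2)]
  have "emeasure \<mu>\<^sub>1 (- C) = 0" "emeasure \<mu>\<^sub>2 (- C) = 0"
    using \<mu> sets C(1) by (simp_all add: msupp_subset_iff)
  moreover have "0 \<notin> C"
    using C(2) zero_notin_Z by blast
  ultimately show "\<mu>\<^sub>1 = \<mu>\<^sub>2"
    using pushforward_determines_measure[OF repr_measuresD(2)[OF repr(1)] repr_measuresD(2)[OF repr(2)] sets]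
      C(1,3) push by blast
qed

lemma msupp_repr_measure:
  assumes "\<mu> \<in> repr_measures \<gamma>" "relation_holds \<gamma>"
  shows "msupp \<mu> \<subseteq> Z"
  using assms relation_holds_iff[OF assms(1)] by (simp add: msupp_subset_iff repr_measuresD(1) closed_Z)

lemma Gamma_of_bij_betw:
  assumes rel: "relation_holds \<gamma>" and inj: "inj_on psi Z"
  shows "bij_betw Gamma_of (repr_measures \<gamma>) (PDE \<gamma>)"
  unfolding bij_betw_def
proof
  have "{\<mu> \<in> repr_measures \<gamma>. msupp \<mu> \<subseteq> Z} = repr_measures \<gamma>"
    using msupp_repr_measure[OF _ rel] by auto
  then show "inj_on Gamma_of (repr_measures \<gamma>)"
    using Gamma_of_inj_on[OF rel closed_Z subset_refl inj] by simp
  show "Gamma_of ` repr_measures \<gamma> = PDE \<gamma>"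
  proof (intro equalityI subsetI)
    fix \<Gamma> assume "\<Gamma> \<in> Gamma_of ` repr_measures \<gamma>"
    then show "\<Gamma> \<in> PDE \<gamma>"
      using Gamma_of_in_PDE repr_measure_null_0[OF _ rel] by blast
  next
    fix \<Gamma> assume \<Gamma>: "\<Gamma> \<in> PDE \<gamma>"
    then obtain \<mu> where \<mu>: "representing_pair \<Gamma> \<mu> (null_measure borel_circle)"
      using PDE_represented[OF \<Gamma> rel inj] by blast
    then show "\<Gamma> \<in> Gamma_of ` repr_measures \<gamma>"
      using representing_pair_Gamma_of[OF \<Gamma> \<mu>] representing_pair_relation(1)[OF \<Gamma> rel \<mu>] by blast
  qed
qed

lemma PDE_pair_determinate:
  assumes rel: "relation_holds \<gamma>" and inj: "inj_on psi Z" and \<Gamma>: "\<Gamma> \<in> PDE \<gamma>"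
  shows "pair_determinate \<Gamma>"
  unfolding pair_determinate_def
proof (rule ex_ex1I)
  obtain \<mu> where "representing_pair \<Gamma> \<mu> (null_measure borel_circle)"
    using PDE_represented[OF \<Gamma> rel inj] by blast
  then show "\<exists>x. representing_pair \<Gamma> (fst x) (snd x)"
    by (metis fst_conv snd_conv)
next
  fix x y
  assume pairs: "representing_pair \<Gamma> (fst x) (snd x)" "representing_pair \<Gamma> (fst y) (snd y)"
  have key: "fst x \<in> repr_measures \<gamma> \<and> snd x = null_measure borel_circle \<and> Gamma_of (fst x) = \<Gamma>"
    if "representing_pair \<Gamma> (fst x) (snd x)" for x
    using representing_pair_relation[OF \<Gamma> rel that] representing_pair_Gamma_of[OF \<Gamma>, of "fst x"] that by simp
  have "fst x \<in> repr_measures \<gamma>" "fst y \<in> repr_measures \<gamma>" "snd x = snd y"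
    "Gamma_of (fst x) = Gamma_of (fst y)"
    using key[OF pairs(1)] key[OF pairs(2)] by simp_all
  then show "x = y"
    using Gamma_of_bij_betw[OF rel inj] by (auto simp: bij_betw_def prod_eq_iff dest: inj_onD)
qed

end

section \<open>The cardinality of the set of extensions\<close>

text \<open>A function is coded by a set of natural numbers, collecting for every argument the sets of natural
numbers that code the real and imaginary part of the value.\<close>

lemma complex_functions_lepoll_reals:
  "(UNIV :: ('a::countable \<Rightarrow> complex) set) \<lesssim> (UNIV :: real set)"
proof -
  obtain h :: "real \<Rightarrow> nat set" where h: "inj h"
    using eqpoll_sym[OF nat_sets_eqpoll_reals] unfolding eqpoll_def bij_betw_def by blast
  define code where "code F = {to_nat (x, b, n) | x b n. n \<in> h (if b then Re (F x) else Im (F x))}"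
    for F :: "'a \<Rightarrow> complex"
  have "inj code"
  proof (rule injI, rule ext)
    fix F H :: "'a \<Rightarrow> complex" and x :: 'a
    assume "code F = code H"
    then have "to_nat (x, b, n) \<in> code F \<longleftrightarrow> to_nat (x, b, n) \<in> code H" for b :: bool and n :: nat
      by simp
    then have "n \<in> h (if b then Re (F x) else Im (F x)) \<longleftrightarrow> n \<in> h (if b then Re (H x) else Im (H x))" for b n
      by (auto simp: code_def inj_eq[OF inj_to_nat])
    then have "h (if b then Re (F x) else Im (F x)) = h (if b then Re (H x) else Im (H x))" for b
      by blast
    from this[of True] this[of False] show "F x = H x"
      using h by (auto simp: complex_eq_iff dest: injD)
  qed
  then have "(UNIV :: ('a \<Rightarrow> complex) set) \<lesssim> (UNIV :: nat set set)"
    by (auto simp: lepoll_def)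
  also have "(UNIV :: nat set set) \<lesssim> (UNIV :: real set)"
    by (rule eqpoll_imp_lepoll[OF nat_sets_eqpoll_reals])
  finally show ?thesis .
qed

lemma PDE_convex:
  assumes "\<Gamma>\<^sub>1 \<in> PDE \<gamma>" "\<Gamma>\<^sub>2 \<in> PDE \<gamma>" "t \<in> {0..1}"
  shows "(\<lambda>k\<in>NN_plus. of_real t * \<Gamma>\<^sub>1 k + of_real (1 - t) * \<Gamma>\<^sub>2 k) \<in> PDE \<gamma>" (is "?\<Gamma> \<in> _")
proof -
  have "pos_def_plus ?\<Gamma>"
  proof (rule pos_def_plusI)
    fix F and c :: "int \<times> int \<Rightarrow> complex"
    assume F: "finite F" "F \<subseteq> NN_plus"
    have "(\<Sum>k\<in>F. \<Sum>l\<in>F. c k * cnj (c l) * ?\<Gamma> (star_add k l))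
        = (\<Sum>k\<in>F. \<Sum>l\<in>F. of_real t * (c k * cnj (c l) * \<Gamma>\<^sub>1 (star_add k l))
            + of_real (1 - t) * (c k * cnj (c l) * \<Gamma>\<^sub>2 (star_add k l)))"
    proof (intro sum.cong refl)
      fix k l assume "k \<in> F" "l \<in> F"
      then have "star_add k l \<in> NN_plus"
        using F(2) by (intro star_add_NN_plus) auto
      then show "c k * cnj (c l) * ?\<Gamma> (star_add k l) = of_real t * (c k * cnj (c l) * \<Gamma>\<^sub>1 (star_add k l))
            + of_real (1 - t) * (c k * cnj (c l) * \<Gamma>\<^sub>2 (star_add k l))"
        by (simp add: algebra_simps)
    qed
    also have "\<dots> = of_real t * (\<Sum>k\<in>F. \<Sum>l\<in>F. c k * cnj (c l) * \<Gamma>\<^sub>1 (star_add k l))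
        + of_real (1 - t) * (\<Sum>k\<in>F. \<Sum>l\<in>F. c k * cnj (c l) * \<Gamma>\<^sub>2 (star_add k l))"
      by (simp only: sum.distrib sum_distrib_left)
    also have "\<dots> \<in> \<real>\<^sub>\<ge>\<^sub>0"
      using assms F by (intro nonneg_Reals_add_I nonneg_Reals_mult_I pos_def_plus_sum)
        (auto simp: PDE_def complex_nonneg_Reals_iff)
    finally show "(\<Sum>k\<in>F. \<Sum>l\<in>F. c k * cnj (c l) * ?\<Gamma> (star_add k l)) \<in> \<real>\<^sub>\<ge>\<^sub>0" .
  qed
  moreover have "?\<Gamma> k = \<gamma> k" if "k \<in> NN" for k
  proof -
    have "?\<Gamma> k = of_real t * \<gamma> k + of_real (1 - t) * \<gamma> k"
      using that NN_subset_NN_plus assms by (auto simp: PDE_def)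
    also have "\<dots> = \<gamma> k"
      by (simp add: algebra_simps)
    finally show ?thesis .
  qed
  ultimately show ?thesis
    by (simp add: PDE_def)
qed

lemma PDE_continuum:
  assumes \<Gamma>: "\<Gamma>\<^sub>1 \<in> PDE \<gamma>" "\<Gamma>\<^sub>2 \<in> PDE \<gamma>" "\<Gamma>\<^sub>1 \<noteq> \<Gamma>\<^sub>2"
  shows "PDE \<gamma> \<approx> (UNIV :: real set)"
proof (rule lepoll_antisym)
  have "PDE \<gamma> \<lesssim> (UNIV :: (int \<times> int \<Rightarrow> complex) set)"
    by (simp add: subset_imp_lepoll)
  also have "\<dots> \<lesssim> (UNIV :: real set)"
    by (rule complex_functions_lepoll_reals)
  finally show "PDE \<gamma> \<lesssim> (UNIV :: real set)" .
  define seg where "seg t = (\<lambda>k\<in>NN_plus. of_real t * \<Gamma>\<^sub>1 k + of_real (1 - t) * \<Gamma>\<^sub>2 k)" for t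
  obtain k where k: "k \<in> NN_plus" "\<Gamma>\<^sub>1 k \<noteq> \<Gamma>\<^sub>2 k"
    using \<Gamma> unfolding PDE_def by (metis (mono_tags, lifting) PiE_ext mem_Collect_eq)
  have "inj_on seg {0..1}"
  proof (rule inj_onI)
    fix t t' assume "seg t = seg t'"
    then have "seg t k = seg t' k" by simp
    then have "complex_of_real (t - t') * (\<Gamma>\<^sub>1 k - \<Gamma>\<^sub>2 k) = 0"
      using k(1) by (simp add: seg_def algebra_simps)
    with k(2) show "t = t'" by simp
  qed
  moreover have "seg ` {0..1} \<subseteq> PDE \<gamma>"
    using PDE_convex[OF \<Gamma>(1,2)] by (auto simp: seg_def)
  ultimately have "{0..1 :: real} \<lesssim> PDE \<gamma>"
    by (auto simp: lepoll_def)
  then show "(UNIV :: real set) \<lesssim> PDE \<gamma>"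
    using closed_interval_eqpoll_reals[of 0 1] by (meson eqpoll_imp_lepoll eqpoll_sym lepoll_trans zero_less_one)
qed

section \<open>The moment problem on the zero set of a polynomial\<close>

lemma zero_set_expansion:
  "\<exists>S \<alpha>. finite S \<and> S \<subseteq> NN \<and> (\<forall>z. poly (poly p [:cnj z:]) z = (\<Sum>k\<in>S. \<alpha> k * mono_zz k z))"
proof -
  define I where "I = (SIGMA n:{..degree p}. {..degree (coeff p n)})"
  define e where "e = (\<lambda>(n, m). (int m, int n))"
  define \<alpha> where "\<alpha> k = coeff (coeff p (nat (snd k))) (nat (fst k))" for k
  have inj: "inj_on e I"
    by (auto simp: inj_on_def e_def)
  have "poly (poly p [:cnj z:]) z = (\<Sum>k\<in>e ` I. \<alpha> k * mono_zz k z)" for z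
  proof -
    have "poly (poly p [:cnj z:]) z = (\<Sum>n\<le>degree p. poly (coeff p n) z * cnj z ^ n)"
      by (simp add: poly_altdef[of p] poly_sum)
    also have "\<dots> = (\<Sum>n\<le>degree p. \<Sum>m\<le>degree (coeff p n). coeff (coeff p n) m * (z ^ m * cnj z ^ n))"
      by (simp add: poly_altdef sum_distrib_right mult.assoc)
    also have "\<dots> = (\<Sum>(n, m)\<in>I. coeff (coeff p n) m * (z ^ m * cnj z ^ n))"
      unfolding I_def by (subst sum.Sigma) auto
    also have "\<dots> = (\<Sum>k\<in>e ` I. \<alpha> k * mono_zz k z)"
      by (subst sum.reindex[OF inj]) (auto simp: e_def \<alpha>_def mono_zz_def intro!: sum.cong)
    finally show ?thesis .
  qed
  moreover have "finite (e ` I)" "e ` I \<subseteq> NN"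
    by (auto simp: I_def e_def NN_def)
  ultimately show ?thesis by blast
qed

theorem theorem22:
  fixes p :: "complex poly poly" and \<gamma> :: "int \<times> int \<Rightarrow> complex"
  assumes "zero_set p \<noteq> {}" and "0 \<notin> zero_set p"
    and "complex_moment_seq \<gamma>"
    and "\<exists>\<mu>\<in>repr_measures \<gamma>. msupp \<mu> \<subseteq> zero_set p"
  shows
    "(\<forall>\<mu>\<in>repr_measures \<gamma>.
        msupp \<mu> \<subseteq> zero_set p \<and> Gamma_of \<mu> \<in> PDE \<gamma> \<and>
        representing_pair (Gamma_of \<mu>) \<mu> (null_measure borel_circle))
   \<and> (\<forall>\<Gamma>\<in>PDE \<gamma>. \<forall>\<mu> \<nu>. representing_pair \<Gamma> \<mu> \<nu> \<longrightarrow>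
        \<mu> \<in> repr_measures \<gamma> \<and> \<nu> = null_measure borel_circle)
   \<and> (\<forall>\<Gamma>\<in>PDE \<gamma>. \<forall>\<mu>\<^sub>1 \<mu>\<^sub>2.
        representing_pair \<Gamma> \<mu>\<^sub>1 (null_measure borel_circle) \<and>
        representing_pair \<Gamma> \<mu>\<^sub>2 (null_measure borel_circle) \<longrightarrow>
        psi_image (zero_set p) \<mu>\<^sub>1 = psi_image (zero_set p) \<mu>\<^sub>2)
   \<and> (\<forall>Z. Z \<noteq> {} \<and> closed Z \<and> Z \<subseteq> zero_set p \<and> inj_on psi Z \<longrightarrow>
        Gamma_of \<in> {\<mu> \<in> repr_measures \<gamma>. msupp \<mu> \<subseteq> Z} \<rightarrow> PDE \<gamma> \<and>
        inj_on Gamma_of {\<mu> \<in> repr_measures \<gamma>. msupp \<mu> \<subseteq> Z})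
   \<and> (inj_on psi (zero_set p) \<longrightarrow>
        bij_betw Gamma_of (repr_measures \<gamma>) (PDE \<gamma>) \<and>
        (\<forall>\<Gamma>\<in>PDE \<gamma>. pair_determinate \<Gamma>) \<and>
        (moment_indeterminate \<gamma> \<longrightarrow> PDE \<gamma> \<approx> (UNIV :: real set)))"
proof -
  obtain S \<alpha> where S: "finite S" "S \<subseteq> NN" and p: "\<And>z. poly (poly p [:cnj z:]) z = (\<Sum>k\<in>S. \<alpha> k * mono_zz k z)"
    using zero_set_expansion[of p] by blast
  interpret curve S \<alpha>
    using S assms(2) by unfold_locales (auto simp: zero_set_def p[symmetric])
  have Z: "zero_set p = Z"
    by (simp add: zero_set_def Z_def q_def p)
  obtain \<mu>\<^sub>0 where \<mu>\<^sub>0: "\<mu>\<^sub>0 \<in> repr_measures \<gamma>" "msupp \<mu>\<^sub>0 \<subseteq> Z"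
    using assms(4) Z by auto
  then have rel: "relation_holds \<gamma>"
    using relation_holds_iff[OF \<mu>\<^sub>0(1)] by (simp add: msupp_subset_iff repr_measuresD(1) closed_Z)
  have in_PDE: "Gamma_of \<mu> \<in> PDE \<gamma>" if "\<mu> \<in> repr_measures \<gamma>" for \<mu>
    using Gamma_of_in_PDE[OF that repr_measure_null_0[OF that rel]] .
  show ?thesis
    unfolding Z
  proof (intro conjI ballI allI impI)
    fix \<mu> assume \<mu>: "\<mu> \<in> repr_measures \<gamma>"
    show "msupp \<mu> \<subseteq> Z" "Gamma_of \<mu> \<in> PDE \<gamma>"
      "representing_pair (Gamma_of \<mu>) \<mu> (null_measure borel_circle)"
      using msupp_repr_measure[OF \<mu> rel] in_PDE[OF \<mu>] repr_measure_representing_pair[OF \<mu> rel] by blast+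
  next
    fix \<Gamma> \<mu> \<nu> assume "\<Gamma> \<in> PDE \<gamma>" "representing_pair \<Gamma> \<mu> \<nu>"
    then show "\<mu> \<in> repr_measures \<gamma>" "\<nu> = null_measure borel_circle"
      using representing_pair_relation rel by blast+
  next
    fix \<Gamma> \<mu>\<^sub>1 \<mu>\<^sub>2
    assume \<Gamma>: "\<Gamma> \<in> PDE \<gamma>" and pairs: "representing_pair \<Gamma> \<mu>\<^sub>1 (null_measure borel_circle) \<and>
        representing_pair \<Gamma> \<mu>\<^sub>2 (null_measure borel_circle)"
    have \<mu>: "\<mu>\<^sub>1 \<in> repr_measures \<gamma>" "\<mu>\<^sub>2 \<in> repr_measures \<gamma>"
      using representing_pair_relation(1)[OF \<Gamma> rel] pairs by blast+
    have "distr \<mu>\<^sub>1 borel psi = distr \<mu>\<^sub>2 borel psi"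
      using representing_pair_Gamma_of[OF \<Gamma>] pairs by (intro Gamma_of_determines_pushforward[OF rel \<mu>]) simp
    moreover have "psi_image Z \<mu> = restrict_space (distr \<mu> borel psi) circle" if "\<mu> \<in> repr_measures \<gamma>" for \<mu>
      using that relation_holds_iff[OF that] rel
      by (intro psi_image_eq closed_Z zero_notin_Z) (auto simp: repr_measuresD(1))
    ultimately show "psi_image Z \<mu>\<^sub>1 = psi_image Z \<mu>\<^sub>2"
      using \<mu> by simp
  next
    fix C assume "C \<noteq> {} \<and> closed C \<and> C \<subseteq> Z \<and> inj_on psi C"
    then show "Gamma_of \<in> {\<mu> \<in> repr_measures \<gamma>. msupp \<mu> \<subseteq> C} \<rightarrow> PDE \<gamma>"
      "inj_on Gamma_of {\<mu> \<in> repr_measures \<gamma>. msupp \<mu> \<subseteq> C}"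
      using in_PDE Gamma_of_inj_on[OF rel] by auto
  next
    assume inj: "inj_on psi Z"
    show bij: "bij_betw Gamma_of (repr_measures \<gamma>) (PDE \<gamma>)"
      by (rule Gamma_of_bij_betw[OF rel inj])
    show "pair_determinate \<Gamma>" if "\<Gamma> \<in> PDE \<gamma>" for \<Gamma>
      by (rule PDE_pair_determinate[OF rel inj that])
    assume "moment_indeterminate \<gamma>"
    then obtain \<mu> where "\<mu> \<in> repr_measures \<gamma>" "\<mu> \<noteq> \<mu>\<^sub>0"
      using \<mu>\<^sub>0(1) by (auto simp: moment_indeterminate_def moment_determinate_def)
    then have "Gamma_of \<mu> \<noteq> Gamma_of \<mu>\<^sub>0"
      using bij \<mu>\<^sub>0(1) by (auto simp: bij_betw_def dest: inj_onD)
    then show "PDE \<gamma> \<approx> (UNIV :: real set)"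
      using \<open>\<mu> \<in> repr_measures \<gamma>\<close> \<mu>\<^sub>0(1) by (intro PDE_continuum[OF in_PDE in_PDE])
  qed
qed

end
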